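(* Assume $y$ is $q$-full. For every $n\ge1$ there is a unique rotational enriched permutation $\Sigma_n$ of $J_1$ of size $n$ minimizing $v(\sigma,\Psi^\circ)$ among all rotational enriched permutations $\sigma$ of $J_1$ of size $n$. Moreover, setting $\Sigma_0$ to be the empty permutation and $\nu_n=v(\Sigma_n,\Psi^\circ)-v(\Sigma_{n-1},\Psi^\circ)$, one has $\nu_{n+1}>\nu_n$ for all $n\ge1$.
   Context: Let $q=p^b$, $p$ prime. Write $y\in\mathbb{Z}_p$ as $y=\sum_{i=1}^b p^{i-1}y_i$, $y_i=\sum_{j\ge0}y_{i,j}q^j$ with $0\le y_{i,j}<p$; $y$ is $q$-full if no $y_i$ is a non-negative integer. Indices $i$ are taken in $\mathbb{Z}/b\mathbb{Z}$. With indeterminates $\pi,\theta$, let $\beta_i=\prod_{j\ge0}(1-\pi^{q^jp^{i-1}}\theta)^{y_{i,j}}\in\mathbb{F}_p[[\pi]][[\theta]]$, $\beta_i=\sum_{n\ge0}a_{i,n}\theta^n$, and $a_{i,n}=0$ for $n<0$. Let $J_1=\mathbb{Z}/b\mathbb{Z}\times\mathbb{Z}_{>0}$; for $k=(i,m)$ write $\mathbf{i}(k)=i$, $|k|=m$. Let $\Psi^\circ$ be the $J_1\times J_1$ matrix with $\Psi^\circ_{k_1,k_2}=a_{\mathbf{i}(k_1),\,p|k_1|-|k_2|}$ if $\mathbf{i}(k_2)=\mathbf{i}(k_1)-1$ and $0$ otherwise. An enriched permutation is a pair $(S,\sigma)$ with $S\subset J_1$ finite and $\sigma$ a permutation of $S$;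 it is rotational if $\mathbf{i}(\sigma(k))=\mathbf{i}(k)-1$ for all $k\in S$, in which case its size is $|S|/b$. Set $v(\sigma,\Psi^\circ)=\sum_{k\in S}v_\pi(\Psi^\circ_{k,\sigma(k)})\in\mathbb{Z}_{\ge0}\cup\{\infty\}$, with $v_\pi$ the $\pi$-adic valuation. *)

theory Defs
  imports "HOL-Computational_Algebra.Formal_Power_Series" "HOL-Combinatorics.Permutations"
    "HOL-Library.Extended_Nat" "Berlekamp_Zassenhaus.Finite_Field"
begin

text \<open>Conventions. The prime p is CARD('p) and F_p is the type 'p mod_ring.
  A p-adic integer y is given by its digit sequence y :: nat => nat (y k < p), i.e.
  y = sum_k y k * p^k. The paper's index i in {1..b} (= Z/bZ) is represented by
  i in {0..<b} (paper index i+1), so y_{i+1,j} = y (i + b*j) and p^{(i+1)-1} = p^i.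
  Elements of F_p[[pi]][[theta]] are of type 'p mod_ring fps fps
  (outer variable theta, inner variable pi).\<close>

definition ydig :: "nat \<Rightarrow> (nat \<Rightarrow> nat) \<Rightarrow> nat \<Rightarrow> nat \<Rightarrow> nat" where
  "ydig b y i j = y (i + b * j)"

definition p_digits :: "'p::prime_card itself \<Rightarrow> (nat \<Rightarrow> nat) \<Rightarrow> bool" where
  "p_digits _ y \<longleftrightarrow> (\<forall>k. y k < CARD('p))"

text \<open>q-full: no y_i is a non-negative integer, i.e. the q-adic digits of each y_i are
  not eventually zero.\<close>
definition q_full :: "nat \<Rightarrow> (nat \<Rightarrow> nat) \<Rightarrow> bool" where
  "q_full b y \<longleftrightarrow> (\<forall>i<b. infinite {j. ydig b y i j \<noteq> 0})"

definition beta_part :: "'p::prime_card itself \<Rightarrow> nat \<Rightarrow> (nat \<Rightarrow> nat) \<Rightarrow> nat \<Rightarrow> nat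
    \<Rightarrow> 'p mod_ring fps fps" where
  "beta_part _ b y i N =
     (\<Prod>j<N. (1 - fps_const (fps_X ^ ((CARD('p) ^ b) ^ j * CARD('p) ^ i)) * fps_X)
                ^ ydig b y i j)"

text \<open>a_{i,n} in F_p[[pi]], the theta^n coefficient of the infinite product beta_i.
  Its pi^m coefficient is determined by the partial product over j < m+1, since
  the factors with j > m are congruent to 1 modulo pi^(m+1).\<close>
definition a_coeff :: "'p::prime_card itself \<Rightarrow> nat \<Rightarrow> (nat \<Rightarrow> nat) \<Rightarrow> nat \<Rightarrow> int
    \<Rightarrow> 'p mod_ring fps" where
  "a_coeff T b y i n =
     (if n < 0 then 0
      else Abs_fps (\<lambda>m. fps_nth (fps_nth (beta_part T b y i (Suc m)) (nat n)) m))"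

definition vpi :: "'a::zero fps \<Rightarrow> enat" where
  "vpi f = (if f = 0 then \<infinity> else enat (subdegree f))"

definition J1 :: "nat \<Rightarrow> (nat \<times> nat) set" where
  "J1 b = {0..<b} \<times> {0<..}"

definition Psi :: "'p::prime_card itself \<Rightarrow> nat \<Rightarrow> (nat \<Rightarrow> nat) \<Rightarrow> nat \<times> nat \<Rightarrow> nat \<times> nat
    \<Rightarrow> 'p mod_ring fps" where
  "Psi T b y k1 k2 =
     (if (fst k2 + 1) mod b = fst k1
      then a_coeff T b y (fst k1) (int CARD('p) * int (snd k1) - int (snd k2))
      else 0)"

type_synonym enriched_perm = "(nat \<times> nat) set \<times> ((nat \<times> nat) \<Rightarrow> (nat \<times> nat))"

text \<open>Enriched permutation (S, sigma) of J1: S finite subset of J1, sigma a permutation of S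
  (identity outside S). Rotational of size n: i(sigma k) = i(k) - 1 for k in S, and |S| = n b.\<close>
definition rotational_of_size :: "nat \<Rightarrow> nat \<Rightarrow> enriched_perm \<Rightarrow> bool" where
  "rotational_of_size b n E \<longleftrightarrow>
     finite (fst E) \<and> fst E \<subseteq> J1 b \<and> snd E permutes fst E \<and>
     (\<forall>k\<in>fst E. (fst (snd E k) + 1) mod b = fst k) \<and> card (fst E) = n * b"

definition vsig :: "'p::prime_card itself \<Rightarrow> nat \<Rightarrow> (nat \<Rightarrow> nat) \<Rightarrow> enriched_perm \<Rightarrow> enat" where
  "vsig T b y E = (\<Sum>k\<in>fst E. vpi (Psi T b y k (snd E k)))"

end

theory Submission
  imports Defs "HOL-Library.Multiset"
begin

text \<open>The coefficient of theta to the r in beta_i has pi-valuation equal to the sum of the r smallest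
  exponents occurring in the product (``tokens''), where an exponent p to the t occurs at most p - 1
  times. As a function of r this sum is convex, and strictly so over distances of at least p - 1, so
  a minimizing permutation is monotone on each class and splits into n cycles, each a vector x with one coordinate
  in every class, which form a strictly increasing chain. The weight of a single vector is a number
  whose base p digits count its tokens, so that weights of different vectors differ.

  Uniqueness: the largest vector of a minimal chain of length n is the lightest admissible vector with
  all coordinates at least n. If a lighter one existed, then part of the chain could be pushed
  down by one; the tokens gained are distinct and smaller than one of the tokens lost, hence their
  sum is smaller. The rest of the chain is determined by induction.

  Strict convexity: sort chains of lengths n + 1 and n - 1 together coordinatewise and deal the
  result out alternately. This gives two chains of length n of no larger total weight, which would
  have to coincide if the inequality were not strict.\<close>

section \<open>Counting and coordinatewise sorting\<close>

lemma sum_even_odd: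
  fixes g :: "nat \<Rightarrow> 'a::comm_monoid_add"
  shows "(\<Sum>i<2 * m. g i) = (\<Sum>k<m. g (2 * k)) + (\<Sum>k<m. g (2 * k + 1))"
  by (induction m) (simp_all add: algebra_simps)

lemma count_mset_ge_card:
  assumes "I \<subseteq> {..<length xs}" "\<And>i. i \<in> I \<Longrightarrow> xs ! i = v"
  shows "card I \<le> count (mset xs) v"
proof -
  have "card I \<le> card {i. i < length xs \<and> xs ! i = v}" using assms by (intro card_mono) auto
  then show ?thesis
    by (simp add: count_mset count_list_eq_length_filter length_filter_conv_card eq_commute)
qed

text \<open>Insertion uses only infima and suprema of pairs of vectors, so that submodularity of the
  weight can be applied at every step, while each coordinate undergoes an ordinary
  insertion.\<close>

primrec vinsert :: "('a \<Rightarrow> 'b::linorder) \<Rightarrow> ('a \<Rightarrow> 'b) list \<Rightarrow> ('a \<Rightarrow> 'b) list" where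
  "vinsert v [] = [v]"
| "vinsert v (z # zs) = (\<lambda>l. min (z l) (v l)) # vinsert (\<lambda>l. max (z l) (v l)) zs"

definition vsort :: "('a \<Rightarrow> 'b::linorder) list \<Rightarrow> ('a \<Rightarrow> 'b) list" where
  "vsort vs = foldr vinsert vs []"

lemma mset_vinsert: "mset (map (\<lambda>x. x l) (vinsert v zs)) = add_mset (v l) (mset (map (\<lambda>x. x l) zs))"
  by (induction zs arbitrary: v) (auto simp: min_def max_def)

lemma mset_vsort: "mset (map (\<lambda>x. x l) (vsort vs)) = mset (map (\<lambda>x. x l) vs)"
  by (induction vs) (simp_all add: vsort_def mset_vinsert del: mset_map)

lemma sorted_vinsert:
  "sorted (map (\<lambda>x. x l) zs) \<Longrightarrow> sorted (map (\<lambda>x. x l) (vinsert v zs))"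
proof (induction zs arbitrary: v)
  case (Cons z zs)
  have "set (map (\<lambda>x. x l) (vinsert u zs)) = insert (u l) (set (map (\<lambda>x. x l) zs))" for u
    by (metis mset_vinsert set_mset_add_mset_insert set_mset_mset)
  then show ?case using Cons by (force simp: min_le_iff_disj simp del: set_map)
qed simp

lemma sorted_vsort: "sorted (map (\<lambda>x. x l) (vsort vs))"
  by (induction vs) (simp_all add: vsort_def sorted_vinsert)

section \<open>Minimal chains of admissible vectors\<close>

text \<open>The s-th smallest token (counted from 0) with label l is p to the expo l s.\<close>

locale cyclic_tokens =
  fixes p b :: nat and expo :: "nat \<Rightarrow> nat \<Rightarrow> nat"
  assumes p_ge2: "2 \<le> p" and b_pos: "0 < b"
    and expo_mono: "l < b \<Longrightarrow> s \<le> s' \<Longrightarrow> expo l s \<le> expo l s'"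
    and expo_class: "l < b \<Longrightarrow> l' < b \<Longrightarrow> expo l s = expo l' s' \<Longrightarrow> l = l'"
    and expo_shift: "l < b \<Longrightarrow> expo l s < expo l (s + (p - 1))"
begin

definition cyc_suc :: "nat \<Rightarrow> nat" where "cyc_suc l = (l + 1) mod b"

text \<open>The condition that no theta-index along the cycle of x is negative, that is, that all
  matrix entries on the cycle are non-zero.\<close>

definition admissible :: "(nat \<Rightarrow> nat) \<Rightarrow> bool" where
  "admissible x \<longleftrightarrow> (\<forall>l<b. x l \<le> p * x (cyc_suc l))"

text \<open>The number of tokens used on the edge from class \<open>cyc_suc l\<close> to class
  \<open>l\<close>. The truncated subtraction is exact for admissible vectors.\<close>

definition arg :: "(nat \<Rightarrow> nat) \<Rightarrow> nat \<Rightarrow> nat" where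
  "arg x l = p * x (cyc_suc l) - x l"

definition token_sum :: "nat \<Rightarrow> nat \<Rightarrow> nat" where
  "token_sum l m = (\<Sum>s<m. p ^ expo l s)"

definition weight :: "(nat \<Rightarrow> nat) \<Rightarrow> nat" where
  "weight x = (\<Sum>l<b. token_sum l (arg x l))"

lemma cyc_suc_less [simp]: "cyc_suc l < b"
  using b_pos by (simp add: cyc_suc_def)

lemma cyc_suc_surj:
  assumes "l < b" shows "\<exists>m<b. cyc_suc m = l"
proof (cases l)
  case 0
  then show ?thesis using b_pos by (intro exI[of _ "b - 1"]) (auto simp: cyc_suc_def)
next
  case (Suc k)
  then show ?thesis using assms by (intro exI[of _ k]) (auto simp: cyc_suc_def)
qed

lemma bij_cyc_suc: "bij_betw cyc_suc {..<b} {..<b}"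
proof -
  have "cyc_suc ` {..<b} = {..<b}" using cyc_suc_surj by (auto simp: image_iff)
  then show ?thesis by (simp add: bij_betw_def eq_card_imp_inj_on)
qed

section \<open>Convexity of token sums\<close>

lemma token_sum_mono: "m \<le> m' \<Longrightarrow> token_sum l m \<le> token_sum l m'"
  unfolding token_sum_def by (intro sum_mono2) auto

lemma token_sum_Suc: "token_sum l (Suc m) = token_sum l m + p ^ expo l m"
  by (simp add: token_sum_def)

lemma token_sum_add: "token_sum l (m + d) = token_sum l m + (\<Sum>s<d. p ^ expo l (m + s))"
  by (induction d) (auto simp: token_sum_def)

lemma token_sum_convex:
  assumes "l < b" "m \<le> m'"
  shows "token_sum l (m + d) + token_sum l m' \<le> token_sum l m + token_sum l (m' + d)"
proof -
  have "(\<Sum>s<d. p ^ expo l (m + s)) \<le> (\<Sum>s<d. p ^ expo l (m' + s))"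
    using assms p_ge2 by (intro sum_mono power_increasing expo_mono) auto
  then show ?thesis by (simp add: token_sum_add)
qed

text \<open>After p - 1 steps the exponents have grown, so the later tokens exceed the earlier ones
  term by term.\<close>

lemma token_sum_convex_strict:
  assumes "l < b" "m + (p - 1) \<le> m'" "0 < d"
  shows "token_sum l (m + d) + token_sum l m' < token_sum l m + token_sum l (m' + d)"
proof -
  have "expo l (m + s) < expo l (m' + s)" for s
  proof -
    have "expo l (m + s) < expo l (m + s + (p - 1))" using expo_shift assms(1) .
    also have "\<dots> \<le> expo l (m' + s)" using assms by (intro expo_mono) auto
    finally show ?thesis .
  qed
  then have "(\<Sum>s<d. p ^ expo l (m + s)) < (\<Sum>s<d. p ^ expo l (m' + s))"
    using assms p_ge2 by (intro sum_strict_mono power_strict_increasing) auto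
  then show ?thesis by (simp add: token_sum_add)
qed

section \<open>Token sums as numbers in base p\<close>

lemma card_fiber:
  assumes "l < b"
  shows "finite {s. expo l s = t}" "card {s. expo l s = t} \<le> p - 1"
proof -
  \<comment> \<open>Beyond its least element s0 a fibre extends fewer than p - 1 further steps,
    because \<open>expo_shift\<close> has raised the exponent by then.\<close>
  have sub: "{s. expo l s = t} \<subseteq> {s0..<s0 + (p - 1)}" if "s0 = (LEAST s. expo l s = t)" for s0
  proof
    fix s assume s: "s \<in> {s. expo l s = t}"
    then have "s0 \<le> s" "expo l s0 = t" using that by (auto intro: Least_le LeastI)
    moreover have "\<not> s0 + (p - 1) \<le> s"
      using s expo_shift[OF assms, of s0] expo_mono[OF assms, of "s0 + (p - 1)" s] \<open>expo l s0 = t\<close>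
      by auto
    ultimately show "s \<in> {s0..<s0 + (p - 1)}" by auto
  qed
  show "finite {s. expo l s = t}" using sub[OF refl] by (rule finite_subset) simp
  show "card {s. expo l s = t} \<le> p - 1" using card_mono[OF _ sub[OF refl]] by simp
qed

text \<open>Every exponent is carried by at most p - 1 tokens, so sums of distinct tokens have no carries
  in base p.\<close>

lemma sum_tokens_less:
  assumes "Q \<subseteq> {..<b} \<times> UNIV" and "\<And>l s. (l, s) \<in> Q \<Longrightarrow> expo l s < t"
  shows "finite Q" "(\<Sum>(l, s)\<in>Q. p ^ expo l s) < p ^ t"
proof -
  define F where "F r = {(l, s). l < b \<and> expo l s = r}" for r
  \<comment> \<open>By \<open>expo_class\<close> all tokens of exponent r carry the same label, so
    the bound for one label holds for all labels together.\<close>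
  have F: "finite (F r)" "card (F r) \<le> p - 1" for r
  proof -
    have "finite (F r) \<and> card (F r) \<le> p - 1"
    proof (cases "F r = {}")
      case False
      then obtain l s where ls: "l < b" "expo l s = r" by (auto simp: F_def)
      have "F r = Pair l ` {s. expo l s = r}"
      proof
        show "F r \<subseteq> Pair l ` {s. expo l s = r}"
        proof
          fix z assume "z \<in> F r"
          then obtain l' s' where z: "z = (l', s')" "l' < b" "expo l' s' = r" by (auto simp: F_def)
          then have "l' = l" using expo_class[of l' l s' s] ls by simp
          then show "z \<in> Pair l ` {s. expo l s = r}" using z by auto
        qed
      qed (use ls in \<open>auto simp: F_def\<close>)
      then show ?thesis using card_fiber[OF ls(1), of r] by (simp add: card_image inj_on_def)
    qed auto
    then show "finite (F r)" "card (F r) \<le> p - 1" by auto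
  qed
  have sub: "Q \<subseteq> (\<Union>r<t. F r)" using assms by (auto simp: F_def)
  then show "finite Q" using F by (rule_tac finite_subset) auto
  have geo: "(\<Sum>r<t. (p - 1) * p ^ r) < p ^ t"
  proof (induction t)
    case (Suc t)
    have "(\<Sum>r<Suc t. (p - 1) * p ^ r) < p ^ t + (p - 1) * p ^ t" using Suc by simp
    also have "\<dots> = (1 + (p - 1)) * p ^ t" by (simp add: algebra_simps)
    also have "1 + (p - 1) = p" using p_ge2 by simp
    finally show ?case by simp
  qed simp
  have "(\<Sum>(l, s)\<in>Q. p ^ expo l s) \<le> (\<Sum>(l, s)\<in>(\<Union>r<t. F r). p ^ expo l s)"
    using sub F by (intro sum_mono2) auto
  also have "\<dots> = (\<Sum>r<t. \<Sum>(l, s)\<in>F r. p ^ expo l s)"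
    using F by (intro sum.UNION_disjoint) (auto simp: F_def)
  also have "\<dots> = (\<Sum>r<t. card (F r) * p ^ r)"
  proof (rule sum.cong)
    fix r
    have "(\<Sum>(l, s)\<in>F r. p ^ expo l s) = (\<Sum>x\<in>F r. p ^ r)"
      by (rule sum.cong) (auto simp: F_def)
    then show "(\<Sum>(l, s)\<in>F r. p ^ expo l s) = card (F r) * p ^ r" by simp
  qed simp
  also have "\<dots> \<le> (\<Sum>r<t. (p - 1) * p ^ r)" using F by (intro sum_mono) auto
  also note geo
  finally show "(\<Sum>(l, s)\<in>Q. p ^ expo l s) < p ^ t" .
qed

lemma total_eq_tokens: "(\<Sum>l<b. token_sum l (u l)) = (\<Sum>(l, s)\<in>Sigma {..<b} (\<lambda>l. {..<u l}). p ^ expo l s)"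
  by (simp add: token_sum_def sum.Sigma)

text \<open>In passing from u to v the token (l0, s0) is lost, and all tokens gained are distinct
  with smaller exponents. By \<open>sum_tokens_less\<close> together they weigh less than the lost
  one.\<close>

lemma total_less:
  assumes l0: "l0 < b" "v l0 \<le> s0" "s0 < u l0"
    and low: "\<And>l s. l < b \<Longrightarrow> u l \<le> s \<Longrightarrow> s < v l \<Longrightarrow> expo l s < expo l0 s0"
  shows "(\<Sum>l<b. token_sum l (v l)) < (\<Sum>l<b. token_sum l (u l))"
proof -
  let ?T = "\<lambda>u. Sigma {..<b} (\<lambda>l. {..<u l :: nat})"
  let ?e = "\<lambda>(l, s). p ^ expo l s"
  have fin: "finite (?T u)" for u by auto
  have "sum ?e (?T v) = sum ?e (?T v \<inter> ?T u) + sum ?e (?T v - ?T u)"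
    using fin by (metis sum.Int_Diff)
  moreover have "sum ?e (?T u) = sum ?e (?T v \<inter> ?T u) + sum ?e (?T u - ?T v)"
    using fin by (metis sum.Int_Diff Int_commute)
  moreover have "sum ?e (?T v - ?T u) < p ^ expo l0 s0"
    using low by (intro sum_tokens_less) auto
  moreover have "?e (l0, s0) \<le> sum ?e (?T u - ?T v)"
    using l0 fin by (intro member_le_sum) auto
  ultimately show ?thesis by (simp add: total_eq_tokens)
qed

text \<open>Among the labels at which u and v differ, one takes the label l0 whose last differing
  token has the largest exponent. The other labels do not share this exponent, so
  \<open>total_less\<close> decides the comparison at l0.\<close>

lemma total_inj:
  assumes eq: "(\<Sum>l<b. token_sum l (v l)) = (\<Sum>l<b. token_sum l (u l))" and "l < b"
  shows "v l = u l"
proof (rule ccontr)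
  assume "v l \<noteq> u l"
  define D where "D = {l. l < b \<and> v l \<noteq> u l}"
  define top where "top l = expo l (max (u l) (v l) - 1)" for l
  have D: "finite D" "D \<noteq> {}" using \<open>v l \<noteq> u l\<close> \<open>l < b\<close> by (auto simp: D_def)
  have "Max (top ` D) \<in> top ` D" using D by (intro Max_in) auto
  then obtain l0 where "l0 \<in> D" "top l0 = Max (top ` D)" by (metis imageE)
  then have l0: "l0 \<in> D" "\<And>l. l \<in> D \<Longrightarrow> top l \<le> top l0" using D by auto
  \<comment> \<open>Formulated for u' and v' so that it serves both possible orders of u and v at
    l0.\<close>
  have less: False if lt: "v' l0 < u' l0" and max: "\<And>l. max (u' l) (v' l) = max (u l) (v l)"
    and ne: "\<And>l. v' l \<noteq> u' l \<longleftrightarrow> v l \<noteq> u l"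
    and eq: "(\<Sum>l<b. token_sum l (v' l)) = (\<Sum>l<b. token_sum l (u' l))" for u' v'
  proof -
    have "(\<Sum>l<b. token_sum l (v' l)) < (\<Sum>l<b. token_sum l (u' l))"
    proof (rule total_less[of l0 v' "u' l0 - 1"])
      fix l s assume ls: "l < b" "u' l \<le> s" "s < v' l"
      have "l \<in> D" using ls ne[of l] by (auto simp: D_def)
      have "expo l s \<le> top l"
        unfolding top_def using ls max[of l] by (intro expo_mono) auto
      also have "\<dots> \<le> top l0" using l0 \<open>l \<in> D\<close> by auto
      also have "top l0 = expo l0 (u' l0 - 1)"
        unfolding top_def using max[of l0] lt by (metis max.absorb1 less_imp_le)
      finally have "expo l s \<le> expo l0 (u' l0 - 1)" .
      moreover have "l \<noteq> l0" using ls lt by auto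
      then have "expo l s \<noteq> expo l0 (u' l0 - 1)"
        using expo_class[of l l0] ls l0 by (auto simp: D_def)
      ultimately show "expo l s < expo l0 (u' l0 - 1)" by simp
    qed (use l0 lt in \<open>auto simp: D_def\<close>)
    then show False using eq by simp
  qed
  show False
  proof (cases "v l0 < u l0")
    case True
    then show False using less[of v u] eq by auto
  next
    case False
    then have "u l0 < v l0" using l0 by (auto simp: D_def)
    moreover have "u l \<noteq> v l \<longleftrightarrow> v l \<noteq> u l" for l by auto
    ultimately show False using less[of u v] eq max.commute by metis
  qed
qed

text \<open>The difference d of two solutions satisfies d l = p * d (cyc_suc l). Its maximum
  therefore has a p-fold multiple that is no larger than itself, and vanishes.\<close>

lemma arg_inj:
  assumes "admissible x" "admissible z" and eq: "\<And>l. l < b \<Longrightarrow> arg x l = arg z l" and "l < b"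
  shows "x l = z l"
proof -
  define d where "d l = \<bar>int (x l) - int (z l)\<bar>" for l
  have d: "d l = int p * d (cyc_suc l)" if "l < b" for l
  proof -
    have "int (arg x l) = int p * int (x (cyc_suc l)) - int (x l)"
      "int (arg z l) = int p * int (z (cyc_suc l)) - int (z l)"
      using assms(1,2) that by (auto simp: arg_def admissible_def of_nat_diff)
    then have "int (x l) - int (z l) = int p * (int (x (cyc_suc l)) - int (z (cyc_suc l)))"
      using eq[OF that] by (simp add: algebra_simps)
    then show ?thesis by (simp add: d_def abs_mult)
  qed
  have bd: "finite (d ` {..<b})" "d ` {..<b} \<noteq> {}" using b_pos by auto
  obtain m where m: "m < b" "d m = Max (d ` {..<b})" using Max_in[OF bd] by auto
  have le: "d k \<le> d m" if "k < b" for k using m bd that by simp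
  obtain k where k: "k < b" "cyc_suc k = m" using cyc_suc_surj m by blast
  have "int p * d m \<le> d m" using d[OF k(1)] le[OF k(1)] k by simp
  moreover have "2 * d m \<le> int p * d m" using p_ge2 by (intro mult_right_mono) (auto simp: d_def)
  moreover have "0 \<le> d m" by (simp add: d_def)
  ultimately have "d m = 0" by linarith
  then have "d l = 0" using le[OF \<open>l < b\<close>] by (simp add: d_def)
  then show ?thesis by (simp add: d_def)
qed

lemma weight_inj: "admissible x \<Longrightarrow> admissible z \<Longrightarrow> weight x = weight z \<Longrightarrow> l < b \<Longrightarrow> x l = z l"
  using total_inj[of "arg x" "arg z"] arg_inj[of x z l] by (auto simp: weight_def)

section \<open>Lattice operations and submodularity of the weight\<close>

abbreviation vmin :: "(nat \<Rightarrow> nat) \<Rightarrow> (nat \<Rightarrow> nat) \<Rightarrow> nat \<Rightarrow> nat" where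
  "vmin x z \<equiv> (\<lambda>l. min (x l) (z l))"

abbreviation vmax :: "(nat \<Rightarrow> nat) \<Rightarrow> (nat \<Rightarrow> nat) \<Rightarrow> nat \<Rightarrow> nat" where
  "vmax x z \<equiv> (\<lambda>l. max (x l) (z l))"

lemma admissible_vmin: "admissible x \<Longrightarrow> admissible z \<Longrightarrow> admissible (vmin x z)"
  by (auto simp: admissible_def min_le_iff_disj min_def)

lemma admissible_vmax: "admissible x \<Longrightarrow> admissible z \<Longrightarrow> admissible (vmax x z)"
  by (auto simp: admissible_def nat_mult_max_right intro: max.mono)

text \<open>The Monge inequality for the function (a, c) -> token_sum l (p * a - c), a consequence
  of convexity. The condition c' <= p * a keeps all four differences exact.\<close>

lemma token_sum_crossing:
  assumes l: "l < b" and "a \<le> a'" "c \<le> c'" "c' \<le> p * a"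
  shows "token_sum l (p * a - c) + token_sum l (p * a' - c') \<le> token_sum l (p * a - c') + token_sum l (p * a' - c)"
proof -
  define m where "m = p * a - c'"
  have pa: "p * a \<le> p * a'" using assms by simp
  have eqs: "p * a - c = m + (c' - c)" "p * a' - c = (p * a' - c') + (c' - c)"
    unfolding m_def using assms(3,4) pa by linarith+
  show ?thesis unfolding eqs m_def[symmetric]
    using token_sum_convex[OF l, of m "p * a' - c'" "c' - c"] diff_le_mono[OF pa, of c'] by (simp add: m_def)
qed

text \<open>From a < a' the two arguments lie at least p apart, which is enough for strict
  convexity.\<close>

lemma token_sum_crossing_strict:
  assumes l: "l < b" and "a < a'" "c < c'" "c' \<le> p * a"
  shows "token_sum l (p * a - c) + token_sum l (p * a' - c') < token_sum l (p * a - c') + token_sum l (p * a' - c)"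
proof -
  define m where "m = p * a - c'"
  have pa: "p * a + p \<le> p * a'" using assms by (metis Suc_leI mult_Suc_right add.commute mult_le_mono2)
  have eqs: "p * a - c = m + (c' - c)" "p * a' - c = (p * a' - c') + (c' - c)"
    unfolding m_def using assms(3,4) pa by linarith+
  show ?thesis unfolding eqs m_def[symmetric]
    using token_sum_convex_strict[OF l, of m "p * a' - c'" "c' - c"] pa assms by (simp add: m_def)
qed

text \<open>Each summand involves two coordinates. If the vectors are ordered alike in both,
  equality holds; otherwise infimum and supremum uncross the pair and
  \<open>token_sum_crossing\<close> applies.\<close>

lemma weight_submodular:
  assumes "admissible x" "admissible z"
  shows "weight (vmin x z) + weight (vmax x z) \<le> weight x + weight z"
  unfolding weight_def sum.distrib[symmetric]
proof (rule sum_mono)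
  fix l assume "l \<in> {..<b}"
  then have l: "l < b" and x: "x l \<le> p * x (cyc_suc l)" and z: "z l \<le> p * z (cyc_suc l)"
    using assms by (auto simp: admissible_def)
  show "token_sum l (arg (vmin x z) l) + token_sum l (arg (vmax x z) l) \<le> token_sum l (arg x l) + token_sum l (arg z l)"
    unfolding arg_def
    using token_sum_crossing[OF l, of "x (cyc_suc l)" "z (cyc_suc l)" "z l" "x l"]
      token_sum_crossing[OF l, of "z (cyc_suc l)" "x (cyc_suc l)" "x l" "z l"] x z
    by (cases "x l \<le> z l"; cases "x (cyc_suc l) \<le> z (cyc_suc l)") (auto simp: min_def max_def)
qed

text \<open>The infimum is the greatest admissible vector below v.\<close>

definition core :: "(nat \<Rightarrow> nat) \<Rightarrow> nat \<Rightarrow> nat" where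
  "core v l = (INF s. p ^ s * v ((cyc_suc ^^ s) l))"

lemma core_le: "core v l \<le> p ^ s * v ((cyc_suc ^^ s) l)"
  unfolding core_def by (rule cINF_lower) auto

lemma core_attained: "\<exists>s. core v l = p ^ s * v ((cyc_suc ^^ s) l)"
proof -
  have "core v l \<in> range (\<lambda>s. p ^ s * v ((cyc_suc ^^ s) l))"
    unfolding core_def by (rule Inf_nat_def1) auto
  then show ?thesis by auto
qed

lemma admissible_core: "admissible (core v)"
  unfolding admissible_def
proof (intro allI impI)
  fix l assume "l < b"
  obtain s where "core v (cyc_suc l) = p ^ s * v ((cyc_suc ^^ s) (cyc_suc l))" using core_attained by blast
  moreover have "core v l \<le> p ^ Suc s * v ((cyc_suc ^^ Suc s) l)" by (rule core_le)
  ultimately show "core v l \<le> p * core v (cyc_suc l)" by (simp add: funpow_swap1 mult.assoc)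
qed

text \<open>Making v admissible costs nothing beyond the truncated arguments of v. If the infimum at
  l is attained at s = 0, only the coordinate \<open>cyc_suc l\<close> may drop; otherwise the
  argument of the core at l is 0.\<close>

lemma arg_core_le: "arg (core v) l \<le> p * v (cyc_suc l) - v l"
proof -
  obtain s where s: "core v l = p ^ s * v ((cyc_suc ^^ s) l)" using core_attained by blast
  show ?thesis
  proof (cases s)
    case 0
    then have "core v l = v l" using s by simp
    moreover have "core v (cyc_suc l) \<le> v (cyc_suc l)" using core_le[of v "cyc_suc l" 0] by simp
    ultimately show ?thesis by (simp add: arg_def diff_le_mono)
  next
    case (Suc r)
    have "core v (cyc_suc l) \<le> p ^ r * v ((cyc_suc ^^ r) (cyc_suc l))" by (rule core_le)
    then have "p * core v (cyc_suc l) \<le> core v l"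
      using s Suc p_ge2 by (simp add: funpow_swap1 mult.assoc)
    then show ?thesis by (simp add: arg_def)
  qed
qed

text \<open>The infimum for v' is attained at an index where v is smaller. This keeps a chain
  strictly increasing when its members are replaced by their cores.\<close>

lemma core_mono_Suc:
  assumes "\<And>l. l < b \<Longrightarrow> v l < v' l" and "l < b"
  shows "core v l < core v' l"
proof -
  obtain s where s: "core v' l = p ^ s * v' ((cyc_suc ^^ s) l)" using core_attained by blast
  have "(cyc_suc ^^ s) l < b" using assms(2) by (induction s) auto
  then have "v ((cyc_suc ^^ s) l) < v' ((cyc_suc ^^ s) l)" using assms by blast
  then have "p ^ s * v ((cyc_suc ^^ s) l) < core v' l" using s p_ge2 by simp
  then show ?thesis using core_le[of v l s] by simp
qed

lemma core_pos:
  assumes "\<And>l. l < b \<Longrightarrow> 0 < v l" and "l < b"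
  shows "0 < core v l"
  using core_mono_Suc[of "\<lambda>_. 0" v l] assms by simp

section \<open>Chains and the uniqueness of minimal chains\<close>

definition chain :: "nat \<Rightarrow> (nat \<Rightarrow> nat) \<Rightarrow> (nat \<Rightarrow> nat \<Rightarrow> nat) \<Rightarrow> bool" where
  "chain n B X \<longleftrightarrow> (\<forall>k<n. admissible (X k) \<and> (\<forall>l<b. 0 < X k l \<and> X k l \<le> B l)) \<and>
     (\<forall>k. Suc k < n \<longrightarrow> (\<forall>l<b. X k l < X (Suc k) l))"

definition cost :: "nat \<Rightarrow> (nat \<Rightarrow> nat \<Rightarrow> nat) \<Rightarrow> nat" where
  "cost n X = (\<Sum>k<n. weight (X k))"

text \<open>The bound B is carried along for induction: below a fixed top vector, the other members
  form a minimal chain for a smaller bound.\<close>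

definition min_chain :: "nat \<Rightarrow> (nat \<Rightarrow> nat) \<Rightarrow> (nat \<Rightarrow> nat \<Rightarrow> nat) \<Rightarrow> bool" where
  "min_chain n B X \<longleftrightarrow> chain n B X \<and> (\<forall>Y. chain n B Y \<longrightarrow> cost n X \<le> cost n Y)"

lemma chain_gap:
  assumes "chain n B X" "k \<le> k'" "k' < n" "l < b"
  shows "X k l + (k' - k) \<le> X k' l"
  using assms(2,3)
proof (induction k' rule: dec_induct)
  case (step m)
  have "X m l < X (Suc m) l" using assms(1,4) step by (auto simp: chain_def)
  then show ?case using step by auto
qed simp

lemma chain_lower:
  assumes "chain n B X" "k < n" "l < b"
  shows "k < X k l"
proof -
  have "0 < X 0 l" using assms by (auto simp: chain_def)
  then show ?thesis using chain_gap[of n B X 0 k l] assms by auto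
qed

lemma chain_upd_top:
  assumes X: "chain (Suc n) B X" and g: "admissible g"
    and B: "\<And>l. l < b \<Longrightarrow> g l \<le> B l"
    and lower: "\<And>l. l < b \<Longrightarrow> 0 < g l" "\<And>k l. n = Suc k \<Longrightarrow> l < b \<Longrightarrow> X k l < g l"
  shows "chain (Suc n) B (X(n := g))"
  using assms unfolding chain_def by (auto simp: less_Suc_eq)

lemma cost_upd_top: "cost (Suc n) (X(n := g)) = cost n X + weight g"
  by (simp add: cost_def)

text \<open>Coordinate l rises by exactly one per step and the next coordinate by at least one. As p
  >= 2, the argument grows by at least one per step, and every extra unit of the next coordinate
  adds p more.\<close>

lemma arg_le_arg_chain:
  assumes X: "chain n B X" and k: "k \<le> k'" "k' < n" and l: "l < b"
    and tight: "X k' l = X k l + (k' - k)" and e: "X k (cyc_suc l) + (k' - k) + e \<le> X k' (cyc_suc l)"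
  shows "arg (X k) l + (k' - k) + p * e \<le> arg (X k') l"
proof -
  have "X k l \<le> p * X k (cyc_suc l)" using X k l by (auto simp: chain_def admissible_def)
  moreover have "p * (X k (cyc_suc l) + (k' - k) + e) \<le> p * X k' (cyc_suc l)" using e by simp
  then have "p * X k (cyc_suc l) + p * (k' - k) + p * e \<le> p * X k' (cyc_suc l)"
    by (simp add: distrib_left)
  moreover have "2 * (k' - k) \<le> p * (k' - k)" using p_ge2 by simp
  ultimately show ?thesis unfolding arg_def tight by linarith
qed

text \<open>Suppose a cheaper admissible vector below the top of the chain exists. On the coordinates
  where it is smaller, all chain members that are in the way are pushed down by one. The tokens
  gained in this way are distinct and lie below the largest token lost, so the cost decreases.\<close>

lemma push_down:
  assumes X: "chain (Suc n) B X" and h: "admissible h"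
    and h_lower: "\<And>l. l < b \<Longrightarrow> n < h l" and h_upper: "\<And>l. l < b \<Longrightarrow> h l \<le> X n l"
    and less: "weight h < weight (X n)"
  shows "\<exists>Y. chain (Suc n) B Y \<and> cost (Suc n) Y < cost (Suc n) X"
proof -
  define C where "C = {l. l < b \<and> h l < X n l}"
  define u where "u = arg (X n)"
  \<comment> \<open>The edges of the top vector that start in C and carry a token. Lowering the
    coordinates in C takes tokens from them, and every edge on which h has fewer tokens is among
    them.\<close>
  define M where "M = {l. l < b \<and> cyc_suc l \<in> C \<and> 0 < u l}"
  have admX: "X k l \<le> p * X k (cyc_suc l)" if "k \<le> n" "l < b" for k l
    using X that by (auto simp: chain_def admissible_def)
  have lost: "l \<in> M" if l: "l < b" "arg h l < u l" for l
  proof -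
    have "p * h (cyc_suc l) < p * X n (cyc_suc l)"
      using l h_upper[OF l(1)] admX[of n l] unfolding u_def arg_def by linarith
    then show ?thesis using l by (auto simp: M_def C_def)
  qed
  have "\<exists>l<b. arg h l < u l"
  proof (rule ccontr)
    assume "\<not> ?thesis"
    then have "weight (X n) \<le> weight h" unfolding weight_def u_def by (intro sum_mono token_sum_mono) auto
    then show False using less by simp
  qed
  then have "M \<noteq> {}" using lost by blast
  then have M: "finite M" "M \<noteq> {}" by (auto simp: M_def)
  define top where "top l = expo l (u l - 1)" for l
  define t where "t = Max (top ` M)"
  have "t \<in> top ` M" unfolding t_def using M by (intro Max_in) auto
  then obtain l0 where l0: "l0 \<in> M" "top l0 = t" by (metis imageE)
  have top_le: "top l \<le> t" if "l \<in> M" for l using that M by (auto simp: t_def)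
  \<comment> \<open>Otherwise h would carry a token of exponent above t that the top vector lacks,
    while every token that h lacks has exponent at most t. Then h would be heavier than the top
    vector. Equality with t is excluded by \<open>expo_class\<close>.\<close>
  have boundary: "expo l (u l) < t" if l: "l < b" "l \<in> C" "cyc_suc l \<notin> C" for l
  proof (rule ccontr)
    assume "\<not> expo l (u l) < t"
    moreover have "l \<noteq> l0" using l l0 by (auto simp: M_def)
    then have "expo l (u l) \<noteq> t"
      using expo_class[of l l0] l l0 by (auto simp: M_def top_def)
    ultimately have gt: "t < expo l (u l)" by simp
    have "X n (cyc_suc l) = h (cyc_suc l)" using l h_upper[of "cyc_suc l"] by (auto simp: C_def)
    then have "u l < arg h l"
      using l admX[of n l] h by (auto simp: u_def arg_def C_def admissible_def)
    then have "weight (X n) < weight h" unfolding weight_def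
    proof (rule total_less[where ?s0.0 = "u l", rotated 2])
      fix m s assume m: "m < b" "arg h m \<le> s" "s < arg (X n) m"
      then have "m \<in> M" using lost[of m] by (auto simp: u_def)
      have "expo m s \<le> top m" unfolding top_def u_def using m by (intro expo_mono) auto
      also have "\<dots> \<le> t" using top_le \<open>m \<in> M\<close> .
      finally show "expo m s < expo l (u l)" using gt by simp
    qed (use l in \<open>auto simp: u_def\<close>)
    then show False using less by simp
  qed
  \<comment> \<open>The coordinates in C where member k lies at the least possible distance below
    the top, so that it must move when the top does.\<close>
  define E where "E k = {l \<in> C. X n l = X k l + (n - k)}" for k
  define V where "V k l = (if l \<in> E k then X k l - 1 else X k l)" for k l
  \<comment> \<open>Lowering by one may destroy admissibility; the core restores it, at a cost
    controlled by \<open>arg_core_le\<close>.\<close>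
  define Y where "Y k = core (V k)" for k
  have EC: "E k \<subseteq> C" and En: "E n = C" for k by (auto simp: E_def)
  have V_pos: "0 < V k l" if "k \<le> n" "l < b" for k l
  proof (cases "l \<in> E k")
    case True
    then have "X n l = X k l + (n - k)" "n + 1 < X n l"
      using h_lower[of l] that by (auto simp: E_def C_def)
    then show ?thesis using True that by (auto simp: V_def)
  next
    case False
    then show ?thesis using X that by (auto simp: V_def chain_def)
  qed
  have V_less: "V k l < V (Suc k) l" if k: "k < n" and l: "l < b" for k l
  proof -
    have lt: "X k l < X (Suc k) l" using X k l by (auto simp: chain_def)
    show ?thesis
    proof (cases "l \<in> E (Suc k) \<and> l \<notin> E k")
      \<comment> \<open>Only the upper member moves here, but it lies at least two above the lower
        one, since the latter is not tight.\<close>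
      case True
      then have "X k l + 1 \<noteq> X (Suc k) l" using k by (auto simp: E_def)
      then show ?thesis using lt True by (auto simp: V_def)
    next
      case False
      have "l \<in> E (Suc k)" if "l \<in> E k"
      proof -
        have "X (Suc k) l + (n - Suc k) \<le> X n l" using chain_gap[OF X, of "Suc k" n l] k l by simp
        then show ?thesis using that lt k by (auto simp: E_def)
      qed
      then show ?thesis using False lt V_pos[of k l] k l by (auto simp: V_def split: if_splits)
    qed
  qed
  have Y: "chain (Suc n) B Y"
    unfolding chain_def
  proof (intro conjI allI impI)
    fix k l assume k: "k < Suc n" and l: "l < b"
    show "0 < Y k l" unfolding Y_def using V_pos k l by (intro core_pos) auto
    have "Y k l \<le> X k l" using core_le[of "V k" l 0] by (auto simp: Y_def V_def split: if_splits)
    also have "\<dots> \<le> B l" using X k l by (auto simp: chain_def)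
    finally show "Y k l \<le> B l" .
  next
    fix k l assume "Suc k < Suc n" "l < b"
    then show "Y k l < Y (Suc k) l" unfolding Y_def using V_less by (intro core_mono_Suc) auto
  qed (auto simp: Y_def admissible_core)
  \<comment> \<open>The only edges that may pick up a token, namely at most one: the target moves
    down and the source does not.\<close>
  define gain where "gain k l \<longleftrightarrow> l \<in> E k \<and> cyc_suc l \<notin> E k" for k l
  define G where "G = {(k, l). k < Suc n \<and> l < b \<and> gain k l}"
  have argY: "arg (Y k) l \<le> (if gain k l then Suc (arg (X k) l)
      else if cyc_suc l \<in> E k then arg (X k) l - 1 else arg (X k) l)" if k: "k \<le> n" and l: "l < b" for k l
  proof -
    have "arg (Y k) l \<le> p * V k (cyc_suc l) - V k l" unfolding Y_def by (rule arg_core_le)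
    also have "\<dots> \<le> (if gain k l then Suc (arg (X k) l)
        else if cyc_suc l \<in> E k then arg (X k) l - 1 else arg (X k) l)"
    proof (cases "cyc_suc l \<in> E k")
      case True
      then have "p * V k (cyc_suc l) = p * X k (cyc_suc l) - p" by (simp add: V_def right_diff_distrib')
      then show ?thesis using True p_ge2 by (auto simp: gain_def V_def arg_def)
    next
      case False
      then show ?thesis using V_pos[OF k l] by (auto simp: gain_def V_def arg_def)
    qed
    finally show ?thesis .
  qed
  \<comment> \<open>The edge l0 of the top vector pays for all gains: it gives up at least its last
    token, which is p to the t.\<close>
  have costs: "token_sum l (arg (Y k) l) + (if k = n \<and> l = l0 then p ^ t else 0)
      \<le> token_sum l (arg (X k) l) + (if gain k l then p ^ expo l (arg (X k) l) else 0)"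
    if k: "k \<le> n" and l: "l < b" for k l
  proof (cases "k = n \<and> l = l0")
    case True
    then have ng: "\<not> gain k l" "cyc_suc l \<in> E k" and pos: "0 < arg (X k) l"
      using l0 En by (auto simp: gain_def M_def u_def)
    then have "token_sum l (arg (Y k) l) + p ^ t \<le> token_sum l (arg (X k) l - 1) + p ^ t"
      using argY[OF k l] by (simp add: token_sum_mono)
    also have "\<dots> = token_sum l (arg (X k) l)"
      using token_sum_Suc[of l "arg (X k) l - 1"] pos l0 True by (simp add: top_def u_def)
    finally show ?thesis using True ng by simp
  next
    case False
    show ?thesis
    proof (cases "gain k l")
      case True
      then show ?thesis using argY[OF k l] False token_sum_mono[of "arg (Y k) l" "Suc (arg (X k) l)" l]
        by (auto simp: token_sum_Suc)
    next
      case ng: False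
      have "arg (Y k) l \<le> arg (X k) l" using argY[OF k l] ng by (auto split: if_splits)
      then show ?thesis using False ng token_sum_mono by auto
    qed
  qed
  \<comment> \<open>If the source lies outside C, the argument is at most that of the top vector and
    \<open>boundary\<close> applies. If it lies in C without being tight, the top vector has at
    least p more tokens on this edge, so \<open>expo_shift\<close> places the gained token strictly
    below \<open>top l\<close>.\<close>
  have low: "expo l (arg (X k) l) < t" if kl: "(k, l) \<in> G" for k l
  proof -
    have k: "k \<le> n" and l: "l < b" "l \<in> E k" "cyc_suc l \<notin> E k" using kl by (auto simp: G_def gain_def)
    have tight: "X n l = X k l + (n - k)" "l \<in> C" using l by (auto simp: E_def)
    have gap: "X k (cyc_suc l) + (n - k) \<le> X n (cyc_suc l)" using chain_gap[OF X k] by simp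
    show ?thesis
    proof (cases "cyc_suc l \<in> C")
      case False
      have "arg (X k) l \<le> u l"
        using arg_le_arg_chain[OF X k _ l(1) tight(1), of 0] gap by (simp add: u_def)
      then have "expo l (arg (X k) l) \<le> expo l (u l)" using l by (intro expo_mono) auto
      then show ?thesis using boundary[OF l(1) tight(2) False] by simp
    next
      case True
      then have "X n (cyc_suc l) \<noteq> X k (cyc_suc l) + (n - k)" using l by (auto simp: E_def)
      then have "arg (X k) l + p \<le> u l"
        using arg_le_arg_chain[OF X k _ l(1) tight(1), of 1] gap by (simp add: u_def)
      then have "arg (X k) l + (p - 1) \<le> u l - 1" "0 < u l" using p_ge2 by auto
      then have "expo l (arg (X k) l) < top l"
        using expo_shift[OF l(1), of "arg (X k) l"] expo_mono[OF l(1)]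
        unfolding top_def by (meson less_le_trans)
      also have "\<dots> \<le> t" using True l \<open>0 < u l\<close> by (intro top_le) (auto simp: M_def)
      finally show ?thesis .
    qed
  qed
  \<comment> \<open>Two members gaining on the same edge are both tight there, so their arguments,
    and hence the gained tokens, differ.\<close>
  have inj: "inj_on (\<lambda>(k, l). (l, arg (X k) l)) G"
  proof -
    have "arg (X k) l < arg (X k') l" if "(k, l) \<in> G" "(k', l) \<in> G" "k < k'" for k k' l
    proof -
      have l: "l < b" "k' \<le> n" "X n l = X k l + (n - k)" "X n l = X k' l + (n - k')"
        using that by (auto simp: G_def gain_def E_def)
      then have "X k' l = X k l + (k' - k)" using that by auto
      moreover have "X k (cyc_suc l) + (k' - k) \<le> X k' (cyc_suc l)"
        using chain_gap[OF X, of k k' "cyc_suc l"] that l by simp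
      ultimately show ?thesis
        using arg_le_arg_chain[OF X, of k k' l 0] that l by simp
    qed
    then have "k = k'" if "(k, l) \<in> G" "(k', l) \<in> G" "arg (X k) l = arg (X k') l" for k k' l
      using that by (metis linorder_neqE_nat less_irrefl)
    then show ?thesis by (auto intro!: inj_onI)
  qed
  have finG: "finite G"
    by (rule finite_subset[of _ "{..<Suc n} \<times> {..<b}"]) (auto simp: G_def)
  have "cost (Suc n) Y + p ^ t = (\<Sum>k<Suc n. \<Sum>l<b. token_sum l (arg (Y k) l) + (if k = n \<and> l = l0 then p ^ t else 0))"
    (is "_ = ?S")
  proof -
    have "(\<Sum>k<Suc n. \<Sum>l<b. if k = n \<and> l = l0 then p ^ t else 0)
        = (\<Sum>k<Suc n. if k = n then p ^ t else 0)"
      using l0 by (intro sum.cong refl) (auto simp: M_def)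
    then show ?thesis by (simp add: cost_def weight_def sum.distrib)
  qed
  also have "?S \<le> (\<Sum>k<Suc n. \<Sum>l<b. token_sum l (arg (X k) l) + (if gain k l then p ^ expo l (arg (X k) l) else 0))"
    using costs by (intro sum_mono) auto
  also have "\<dots> = cost (Suc n) X + (\<Sum>k<Suc n. \<Sum>l<b. if gain k l then p ^ expo l (arg (X k) l) else 0)"
    by (simp add: cost_def weight_def sum.distrib)
  also have "(\<Sum>k<Suc n. \<Sum>l<b. if gain k l then p ^ expo l (arg (X k) l) else 0)
      = (\<Sum>(k, l)\<in>{..<Suc n} \<times> {..<b}. if gain k l then p ^ expo l (arg (X k) l) else 0)"
    by (rule sum.cartesian_product)
  also have "\<dots> = (\<Sum>(k, l)\<in>G. p ^ expo l (arg (X k) l))"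
    by (rule sum.mono_neutral_cong_right) (auto simp: G_def split: if_splits)
  also have "\<dots> = (\<Sum>(l, s)\<in>(\<lambda>(k, l). (l, arg (X k) l)) ` G. p ^ expo l s)"
    using inj by (simp add: sum.reindex case_prod_unfold)
  also have "\<dots> < p ^ t" using low by (intro sum_tokens_less) (auto simp: G_def)
  finally show ?thesis using Y by (intro exI[of _ Y]) simp
qed

text \<open>Replacing the top by its supremum with g gives a chain, so this supremum is no lighter
  than the top. If g were lighter than the top, submodularity would make the infimum lighter too,
  which \<open>push_down\<close> rules out.\<close>

lemma min_chain_top:
  assumes X: "min_chain (Suc n) B X" and g: "admissible g"
    and g_lower: "\<And>l. l < b \<Longrightarrow> n < g l" and g_upper: "\<And>l. l < b \<Longrightarrow> g l \<le> B l"
  shows "weight (X n) \<le> weight g"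
proof (rule ccontr)
  assume less: "\<not> ?thesis"
  have ch: "chain (Suc n) B X" and mn: "\<And>Y. chain (Suc n) B Y \<Longrightarrow> cost (Suc n) X \<le> cost (Suc n) Y"
    using X by (auto simp: min_chain_def)
  have admissible: "admissible (X n)" using ch by (auto simp: chain_def)
  have "chain (Suc n) B (X(n := vmax (X n) g))"
  proof (rule chain_upd_top[OF ch])
    fix l assume l: "l < b"
    show "vmax (X n) g l \<le> B l" using l ch g_upper by (auto simp: chain_def)
    show "0 < vmax (X n) g l" using g_lower[OF l] by auto
  next
    fix k l assume "n = Suc k" "l < b"
    then show "X k l < vmax (X n) g l" using chain_gap[OF ch, of k n l] by auto
  qed (use admissible g admissible_vmax in auto)
  then have "weight (X n) \<le> weight (vmax (X n) g)"
    using mn cost_upd_top[of n X "vmax (X n) g"] cost_upd_top[of n X "X n"] by fastforce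
  then have "weight (vmin (X n) g) < weight (X n)" using weight_submodular[OF admissible g] less by linarith
  moreover have "n < vmin (X n) g l" if "l < b" for l
    using g_lower chain_lower[OF ch, of n l] that by simp
  ultimately show False
    using push_down[OF ch admissible_vmin[OF admissible g]] mn by (meson leD min.cobounded1)
qed

text \<open>By \<open>min_chain_top\<close> the two top vectors have equal weight, so they agree by
  \<open>weight_inj\<close>. The remaining members are minimal among chains strictly below that top,
  which gives the induction.\<close>

lemma min_chain_unique:
  assumes "min_chain n B X" "min_chain n B Y" "k < n" "l < b"
  shows "X k l = Y k l"
  using assms
proof (induction n arbitrary: B X Y k l)
  case (Suc n)
  have ch: "chain (Suc n) B X" "chain (Suc n) B Y" using Suc.prems by (auto simp: min_chain_def)
  then have admissible: "admissible (X n)" "admissible (Y n)" by (auto simp: chain_def)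
  have "weight (X n) = weight (Y n)"
  proof (rule antisym)
    show "weight (X n) \<le> weight (Y n)"
      using min_chain_top[OF Suc.prems(1) admissible(2)] chain_lower[OF ch(2)] ch by (auto simp: chain_def)
    show "weight (Y n) \<le> weight (X n)"
      using min_chain_top[OF Suc.prems(2) admissible(1)] chain_lower[OF ch(1)] ch by (auto simp: chain_def)
  qed
  then have top: "X n l = Y n l" if "l < b" for l using weight_inj admissible that by blast
  have sub: "min_chain n (\<lambda>l. X n l - 1) Z" if Z: "min_chain (Suc n) B Z" and eq: "\<And>l. l < b \<Longrightarrow> Z n l = X n l" for Z
    unfolding min_chain_def
  proof (intro conjI allI impI)
    have chZ: "chain (Suc n) B Z" using Z by (auto simp: min_chain_def)
    have "Z k l \<le> X n l - 1" if "k < n" "l < b" for k l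
      using chain_gap[OF chZ, of k n l] eq that by fastforce
    then show "chain n (\<lambda>l. X n l - 1) Z" using chZ by (auto simp: chain_def)
    fix Y' assume Y': "chain n (\<lambda>l. X n l - 1) Y'"
    have lt: "Y' k l < Z n l" if "k < n" "l < b" for k l
      using Y' that eq[of l] by (fastforce simp: chain_def)
    have "Z n l \<le> B l \<and> 0 < Z n l" if "l < b" for l using chZ that by (auto simp: chain_def)
    then have "Y' k l \<le> B l" if "k < n" "l < b" for k l using lt that by (meson less_imp_le less_le_trans)
    then have "chain (Suc n) B (Y'(n := Z n))"
      using Y' lt chZ unfolding chain_def by (auto simp: less_Suc_eq)
    then have "cost (Suc n) Z \<le> cost (Suc n) (Y'(n := Z n))" using Z by (auto simp: min_chain_def)
    then show "cost n Z \<le> cost n Y'" using cost_upd_top[of n Z "Z n"] by (simp add: cost_upd_top)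
  qed
  show ?case
  proof (cases "k = n")
    case True
    then show ?thesis using top Suc.prems by simp
  next
    case False
    have "min_chain n (\<lambda>l. X n l - 1) X" "min_chain n (\<lambda>l. X n l - 1) Y"
      using sub Suc.prems top by auto
    then show ?thesis using Suc.IH Suc.prems False by (metis less_SucE)
  qed
qed simp

section \<open>Merging two chains\<close>

lemma vinsert_weight:
  assumes "\<And>z. z \<in> set zs \<Longrightarrow> admissible z" "admissible v"
  shows "(\<forall>z\<in>set (vinsert v zs). admissible z) \<and> sum_list (map weight (vinsert v zs)) \<le> weight v + sum_list (map weight zs)"
  using assms
proof (induction zs arbitrary: v)
  case (Cons z zs)
  have a: "admissible z" "admissible v" using Cons.prems by auto
  then have "weight (vmin z v) + weight (vmax z v) \<le> weight z + weight v" by (rule weight_submodular)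
  moreover have "(\<forall>z\<in>set (vinsert (vmax z v) zs). admissible z) \<and>
      sum_list (map weight (vinsert (vmax z v) zs)) \<le> weight (vmax z v) + sum_list (map weight zs)"
    using Cons.prems by (intro Cons.IH admissible_vmax) auto
  ultimately show ?case using admissible_vmin[OF a] by simp
qed simp

lemma vsort_weight:
  assumes "\<And>z. z \<in> set vs \<Longrightarrow> admissible z"
  shows "(\<forall>z\<in>set (vsort vs). admissible z) \<and> sum_list (map weight (vsort vs)) \<le> sum_list (map weight vs)"
  using assms
proof (induction vs)
  case (Cons v vs)
  then have IH: "\<forall>z\<in>set (vsort vs). admissible z" "sum_list (map weight (vsort vs)) \<le> sum_list (map weight vs)"
    and "admissible v" by auto
  then show ?case using vinsert_weight[of "vsort vs" v] by (auto simp: vsort_def)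
qed (simp add: vsort_def)

lemma chain_inj_on:
  assumes X: "chain n B X" and "l < b"
  shows "inj_on (\<lambda>k. X k l) {..<n}"
proof (rule inj_onI)
  fix k k' assume "k \<in> {..<n}" "k' \<in> {..<n}" "X k l = X k' l"
  then have l: "l < b" "k < n" "k' < n" "X k l = X k' l" using \<open>l < b\<close> by auto
  show "k = k'"
  proof (cases "k \<le> k'")
    case True
    then show ?thesis using chain_gap[OF X, of k k' l] l by simp
  next
    case False
    then show ?thesis using chain_gap[OF X, of k' k l] l by simp
  qed
qed

text \<open>The members of both chains are sorted coordinatewise, which does not increase the cost by
  submodularity. Every value occurs at most twice in a coordinate, so that the members at even and
  at odd positions form chains again.\<close>

lemma chain_merge:
  assumes X: "chain (n + 2) B X" and Y: "chain n B Y"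
  obtains A C where "chain (n + 1) B A" "chain (n + 1) B C"
    "cost (n + 1) A + cost (n + 1) C \<le> cost (n + 2) X + cost n Y"
    "\<exists>k<n + 1. A k 0 \<noteq> C k 0"
proof -
  define vs where "vs = map X [0..<n + 2] @ map Y [0..<n]"
  define zs where "zs = vsort vs"
  have admissible: "\<And>z. z \<in> set zs \<Longrightarrow> admissible z" and le: "sum_list (map weight zs) \<le> sum_list (map weight vs)"
  proof -
    have "admissible z" if "z \<in> set vs" for z using that X Y by (auto simp: vs_def chain_def)
    then show "\<And>z. z \<in> set zs \<Longrightarrow> admissible z" "sum_list (map weight zs) \<le> sum_list (map weight vs)"
      using vsort_weight[of vs] by (auto simp: zs_def)
  qed
  have ms: "mset (map (\<lambda>x. x l) zs) = mset (map (\<lambda>x. x l) vs)" for l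
    by (simp only: zs_def mset_vsort)
  have len: "length zs = 2 * (n + 1)"
    using arg_cong[OF ms[of 0], of size] by (simp add: vs_def)
  have sorted: "sorted (map (\<lambda>x. x l) zs)" for l unfolding zs_def by (rule sorted_vsort)
  have bounds: "0 < z l \<and> z l \<le> B l" if "z \<in> set zs" "l < b" for z l
  proof -
    have "z l \<in> set (map (\<lambda>x. x l) vs)"
      using that arg_cong[OF ms[of l], of set_mset] by auto
    then show ?thesis using X Y that by (auto simp: vs_def chain_def)
  qed
  have cnt: "count (mset (map (\<lambda>x. x l) zs)) v =
      (if v \<in> (\<lambda>k. X k l) ` {..<n + 2} then 1 else 0) + (if v \<in> (\<lambda>k. Y k l) ` {..<n} then 1 else 0)"
    if "l < b" for l v
  proof -
    have "distinct (map (\<lambda>k. X k l) [0..<n + 2])" "distinct (map (\<lambda>k. Y k l) [0..<n])"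
      using chain_inj_on[OF X that] chain_inj_on[OF Y that]
      by (simp_all only: distinct_map distinct_upt set_upt lessThan_atLeast0 simp_thms)
    then have "count (mset (map (\<lambda>k. X k l) [0..<n + 2])) v = (if v \<in> (\<lambda>k. X k l) ` {..<n + 2} then 1 else 0)"
      "count (mset (map (\<lambda>k. Y k l) [0..<n])) v = (if v \<in> (\<lambda>k. Y k l) ` {..<n} then 1 else 0)"
      by (simp_all only: distinct_count_atmost_1 set_map set_upt lessThan_atLeast0)
    moreover have "mset (map (\<lambda>x. x l) zs) = mset (map (\<lambda>k. X k l) [0..<n + 2]) + mset (map (\<lambda>k. Y k l) [0..<n])"
      by (simp only: ms vs_def map_append mset_append map_map o_def)
    ultimately show ?thesis by (simp only: count_union)
  qed
  have mono: "(zs ! i) l \<le> (zs ! j) l" if "i \<le> j" "j < length zs" for i j l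
    using sorted_nth_mono[OF sorted, of i j l] that by simp
  have strict: "(zs ! i) l < (zs ! (i + 2)) l" if "i + 2 < length zs" "l < b" for i l
  proof (rule ccontr)
    assume "\<not> ?thesis"
    then have eq: "(zs ! (i + 2)) l = (zs ! i) l" "(zs ! (i + 1)) l = (zs ! i) l"
      using mono[of i "i + 1" l] mono[of "i + 1" "i + 2" l] \<open>i + 2 < length zs\<close> by auto
    have "card {i, i + 1, i + 2} \<le> count (mset (map (\<lambda>x. x l) zs)) ((zs ! i) l)"
    proof (rule count_mset_ge_card)
      fix j assume "j \<in> {i, i + 1, i + 2}"
      then consider "j = i" | "j = i + 1" | "j = i + 2" by blast
      then show "map (\<lambda>x. x l) zs ! j = (zs ! i) l"
        using eq \<open>i + 2 < length zs\<close> by cases auto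
    qed (use \<open>i + 2 < length zs\<close> in auto)
    also have "\<dots> \<le> 1 + 1" unfolding cnt[OF \<open>l < b\<close>] by (intro add_mono) simp_all
    finally show False by simp
  qed
  define A where "A k = zs ! (2 * k)" for k
  define C where "C k = zs ! (2 * k + 1)" for k
  have "chain (n + 1) B A"
    unfolding chain_def A_def using admissible bounds len strict[of "2 * _"] by auto
  moreover have "chain (n + 1) B C"
    unfolding chain_def C_def using admissible bounds len strict[of "2 * _ + 1"] by auto
  moreover have "cost (n + 1) A + cost (n + 1) C \<le> cost (n + 2) X + cost n Y"
  proof -
    have "cost (n + 1) A + cost (n + 1) C = (\<Sum>i<2 * (n + 1). weight (zs ! i))"
      by (simp only: sum_even_odd cost_def A_def C_def)
    also have "\<dots> = sum_list (map weight zs)" using len by (simp add: sum_list_sum_nth lessThan_atLeast0)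
    also note le
    also have "sum_list (map weight vs) = cost (n + 2) X + cost n Y"
      by (simp add: vs_def cost_def interv_sum_list_conv_sum_set_nat lessThan_atLeast0 o_def)
    finally show ?thesis .
  qed
  moreover have "\<exists>k<n + 1. A k 0 \<noteq> C k 0"
  proof (rule ccontr)
    assume "\<not> ?thesis"
    then have pair: "(zs ! (2 * k)) 0 = (zs ! (2 * k + 1)) 0" if "k < n + 1" for k
      using that by (auto simp: A_def C_def)
    \<comment> \<open>X has more members than Y, so some value of coordinate 0 occurs in X only and
      hence once in the merged list. If A and C agreed there, that value would occur twice.\<close>
    have "card ((\<lambda>k. Y k 0) ` {..<n}) < card ((\<lambda>k. X k 0) ` {..<n + 2})"
      using chain_inj_on[OF X b_pos] chain_inj_on[OF Y b_pos] by (simp add: card_image)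
    then have "\<not> (\<lambda>k. X k 0) ` {..<n + 2} \<subseteq> (\<lambda>k. Y k 0) ` {..<n}"
      by (meson card_mono finite_imageI finite_lessThan leD)
    then obtain v where v: "v \<in> (\<lambda>k. X k 0) ` {..<n + 2}" "v \<notin> (\<lambda>k. Y k 0) ` {..<n}" by blast
    then have one: "count (mset (map (\<lambda>x. x 0) zs)) v = 1" using cnt[OF b_pos, of v] by simp
    then have "v \<in> set (map (\<lambda>x. x 0) zs)"
      by (metis count_greater_zero_iff less_numeral_extra(1) set_mset_mset)
    then obtain i where i: "i < length zs" "(zs ! i) 0 = v" by (auto simp: in_set_conv_nth)
    define k where "k = i div 2"
    have k: "k < n + 1" "i = 2 * k \<or> i = 2 * k + 1" using i len by (auto simp: k_def)
    then have eq: "(zs ! (2 * k)) 0 = v" "(zs ! (2 * k + 1)) 0 = v" using pair[OF k(1)] i by auto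
    have "card {2 * k, 2 * k + 1} \<le> count (mset (map (\<lambda>x. x 0) zs)) v"
    proof (rule count_mset_ge_card)
      fix j assume "j \<in> {2 * k, 2 * k + 1}"
      then consider "j = 2 * k" | "j = 2 * k + 1" by blast
      then show "map (\<lambda>x. x 0) zs ! j = v" using eq k len by cases auto
    qed (use k len in auto)
    then show False using one by simp
  qed
  ultimately show ?thesis using that by blast
qed

section \<open>Strict convexity of the minimal cost\<close>

definition best :: "nat \<Rightarrow> (nat \<Rightarrow> nat \<Rightarrow> nat) \<Rightarrow> bool" where
  "best n X \<longleftrightarrow> (\<exists>B. chain n B X) \<and> (\<forall>B Y. chain n B Y \<longrightarrow> cost n X \<le> cost n Y)"

lemma chain_weaken: "chain n B X \<Longrightarrow> (\<And>l. B l \<le> B' l) \<Longrightarrow> chain n B' X"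
  unfolding chain_def by (meson order_trans)

text \<open>The constant vectors 1, ..., n provide a chain of each length, later used as a witness
  of finite cost.\<close>

lemma chain_Suc: "chain n (\<lambda>_. n) (\<lambda>k _. Suc k)"
proof -
  have "Suc k \<le> p * Suc k" for k using p_ge2 by (cases p) auto
  then show ?thesis by (simp add: chain_def admissible_def)
qed

text \<open>The sum of the two bounds is a common bound, which reduces the claim to
  \<open>min_chain_unique\<close>.\<close>

lemma best_unique:
  assumes "best n X" "best n Y" "k < n" "l < b"
  shows "X k l = Y k l"
proof -
  obtain B B' where "chain n B X" "chain n B' Y" using assms by (auto simp: best_def)
  then have "chain n (\<lambda>l. B l + B' l) X" "chain n (\<lambda>l. B l + B' l) Y"
    by (auto elim!: chain_weaken)
  then have "min_chain n (\<lambda>l. B l + B' l) X" "min_chain n (\<lambda>l. B l + B' l) Y"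
    using assms by (auto simp: min_chain_def best_def)
  then show ?thesis using min_chain_unique assms by blast
qed

lemma best_convex:
  assumes X: "best (n + 2) X" and Y: "best n Y" and Z: "best (n + 1) Z"
  shows "2 * cost (n + 1) Z < cost (n + 2) X + cost n Y"
proof -
  obtain B B' where "chain (n + 2) B X" "chain n B' Y" using X Y by (auto simp: best_def)
  then have "chain (n + 2) (\<lambda>l. B l + B' l) X" "chain n (\<lambda>l. B l + B' l) Y"
    by (auto elim!: chain_weaken)
  then obtain A C where AC: "chain (n + 1) (\<lambda>l. B l + B' l) A" "chain (n + 1) (\<lambda>l. B l + B' l) C"
    "cost (n + 1) A + cost (n + 1) C \<le> cost (n + 2) X + cost n Y" "\<exists>k<n + 1. A k 0 \<noteq> C k 0"
    by (rule chain_merge)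
  then have le: "cost (n + 1) Z \<le> cost (n + 1) A" "cost (n + 1) Z \<le> cost (n + 1) C"
    using Z by (auto simp: best_def)
  show ?thesis
  proof (rule ccontr)
    assume "\<not> ?thesis"
    then have "cost (n + 1) A = cost (n + 1) Z" "cost (n + 1) C = cost (n + 1) Z"
      using AC(3) le by linarith+
    then have "best (n + 1) A" "best (n + 1) C" using Z AC(1,2) by (auto simp: best_def)
    then show False using best_unique AC(4) b_pos by blast
  qed
qed

end

unbundle fps_syntax

section \<open>Valuations of the coefficients\<close>

definition digit_sum :: "nat \<Rightarrow> (nat \<Rightarrow> nat) \<Rightarrow> nat \<Rightarrow> nat \<Rightarrow> nat" where
  "digit_sum b y i N = (\<Sum>j<N. ydig b y i j)"

text \<open>Listing each j with multiplicity ydig b y i j, the s-th entry (counted from 0) is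
  digit_index b y i s.\<close>

definition digit_index :: "nat \<Rightarrow> (nat \<Rightarrow> nat) \<Rightarrow> nat \<Rightarrow> nat \<Rightarrow> nat" where
  "digit_index b y i s = (LEAST j. s < digit_sum b y i (Suc j))"

text \<open>The factor of index j contains pi to the power q^j * p^i = p^(i + b * j). For i < b the
  residue of this exponent modulo b recovers the class i.\<close>

definition token_expo :: "nat \<Rightarrow> (nat \<Rightarrow> nat) \<Rightarrow> nat \<Rightarrow> nat \<Rightarrow> nat" where
  "token_expo b y i s = i + b * digit_index b y i s"

lemma digit_sum_Suc: "digit_sum b y i (Suc N) = digit_sum b y i N + ydig b y i N"
  by (simp add: digit_sum_def)

lemma digit_sum_mono: "N \<le> M \<Longrightarrow> digit_sum b y i N \<le> digit_sum b y i M"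
  unfolding digit_sum_def by (intro sum_mono2) auto

text \<open>This is where fullness enters: infinitely many non-zero digits supply arbitrarily many
  tokens.\<close>

lemma digit_sum_unbounded:
  assumes "infinite {j. ydig b y i j \<noteq> 0}"
  shows "\<exists>N. s < digit_sum b y i (Suc N)"
proof (induction s)
  case 0
  obtain j where "ydig b y i j \<noteq> 0" using infinite_imp_nonempty[OF assms] by auto
  then show ?case by (intro exI[of _ j]) (simp add: digit_sum_Suc)
next
  case (Suc s)
  then obtain N where N: "s < digit_sum b y i (Suc N)" by blast
  obtain j where j: "Suc N \<le> j" "ydig b y i j \<noteq> 0"
    using assms by (auto simp: infinite_nat_iff_unbounded_le)
  then have "Suc s < digit_sum b y i (Suc j)"
    using N digit_sum_mono[OF j(1), of b y i] by (simp add: digit_sum_Suc)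
  then show ?case by blast
qed

context
  fixes b :: nat and y :: "nat \<Rightarrow> nat" and i :: nat
  assumes inf: "infinite {j. ydig b y i j \<noteq> 0}"
begin

lemma digit_index_le_iff: "digit_index b y i s \<le> j \<longleftrightarrow> s < digit_sum b y i (Suc j)"
proof
  assume "digit_index b y i s \<le> j"
  moreover have "s < digit_sum b y i (Suc (digit_index b y i s))"
    unfolding digit_index_def using digit_sum_unbounded[OF inf] by (rule LeastI_ex)
  ultimately show "s < digit_sum b y i (Suc j)"
    using digit_sum_mono[of "Suc (digit_index b y i s)" "Suc j" b y i] by simp
qed (auto simp: digit_index_def intro: Least_le)

lemma digit_index_less_iff: "digit_index b y i s < j \<longleftrightarrow> s < digit_sum b y i j"
proof (cases j)
  case (Suc k)
  then show ?thesis using digit_index_le_iff[of s k] by (simp add: less_Suc_eq_le)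
qed (simp add: digit_sum_def)

lemma token_expo_mono: "s \<le> s' \<Longrightarrow> token_expo b y i s \<le> token_expo b y i s'"
  using digit_index_le_iff[of s "digit_index b y i s'"] digit_index_le_iff[of s' "digit_index b y i s'"]
  by (simp add: token_expo_def)

text \<open>A digit is at most p - 1, so p - 1 further tokens leave the current index.\<close>

lemma token_expo_shift:
  assumes "0 < b" "\<And>j. ydig b y i j < p"
  shows "token_expo b y i s < token_expo b y i (s + (p - 1))"
proof -
  define j where "j = digit_index b y i s"
  have "digit_sum b y i j \<le> s" using digit_index_less_iff[of s j] by (simp add: j_def)
  then have "digit_sum b y i (Suc j) \<le> s + (p - 1)" using assms(2)[of j] by (simp add: digit_sum_Suc)
  then have "j < digit_index b y i (s + (p - 1))" using digit_index_le_iff[of "s + (p - 1)" j] by simp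
  then show ?thesis using assms(1) by (simp add: token_expo_def j_def)
qed

end

section \<open>Lowest terms of the coefficients\<close>

lemma one_minus_const_X_power_nth:
  fixes c :: "'a::comm_ring_1"
  shows "((1 - fps_const c * fps_X) ^ m) $ s = of_nat (m choose s) * (- c) ^ s"
proof -
  have "(1 - fps_const c * fps_X) ^ m = (fps_const (- c) * fps_X + 1) ^ m"
    by (simp flip: fps_const_neg)
  also have "\<dots> = (\<Sum>k\<le>m. of_nat (m choose k) * (fps_const (- c) * fps_X) ^ k * 1 ^ (m - k))"
    by (rule binomial_ring)
  also have "\<dots> = (\<Sum>k\<le>m. fps_const (of_nat (m choose k) * (- c) ^ k) * fps_X ^ k)"
    by (simp add: power_mult_distrib mult.assoc flip: fps_of_nat fps_const_mult)
  also have "\<dots> $ s = (\<Sum>k\<le>m. if k = s then of_nat (m choose k) * (- c) ^ k else 0)"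
    unfolding fps_sum_nth by (intro sum.cong refl) (simp add: fps_X_power_nth)
  also have "\<dots> = of_nat (m choose s) * (- c) ^ s"
    by (simp add: sum.delta' binomial_eq_0)
  finally show ?thesis .
qed

text \<open>The binomial coefficient divides m!, which is prime to p for m < p.\<close>

lemma of_nat_binomial_mod_ring_neq_0:
  assumes "m < CARD('p::prime_card)" "s \<le> m"
  shows "(of_nat (m choose s) :: 'p mod_ring) \<noteq> 0"
proof
  assume "(of_nat (m choose s) :: 'p mod_ring) = 0"
  then have "CARD('p) dvd (m choose s)" by (rule of_nat_0_mod_ring_dvd)
  also have "(m choose s) dvd fact m"
    using binomial_fact_lemma[OF assms(2)] by (metis dvd_triv_right)
  finally show False using assms(1) prime_card[where 'a = 'p] by (simp add: prime_dvd_fact_iff)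
qed

text \<open>The coefficient of theta to the r has as its lowest term the product of the r smallest tokens;
  its coefficient is a product of binomial coefficients of digits, hence a unit.\<close>

lemma beta_part_nth:
  fixes T :: "'p::prime_card itself" and b :: nat and y :: "nat \<Rightarrow> nat"
  defines "F \<equiv> \<lambda>i r. \<Sum>s<r. CARD('p) ^ token_expo b y i s"
  assumes inf: "infinite {j. ydig b y i j \<noteq> 0}" and dig: "\<And>j. ydig b y i j < CARD('p)" and b: "0 < b"
  shows "(r \<le> digit_sum b y i N \<longrightarrow> (\<forall>m<F i r. beta_part T b y i N $ r $ m = 0) \<and>
      beta_part T b y i N $ r $ F i r \<noteq> 0) \<and>
    (digit_sum b y i N < r \<longrightarrow> beta_part T b y i N $ r = 0)"
proof (induction N arbitrary: r)
  case 0
  show ?case by (simp add: beta_part_def digit_sum_def F_def)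
next
  case (Suc N)
  define P where "P = beta_part T b y i N"
  define d where "d = digit_sum b y i N"
  define v where "v = ydig b y i N"
  define e where "e = CARD('p) ^ (i + b * N)"
  define k where "k s = (of_nat (v choose s) * (- 1) ^ s :: 'p mod_ring)" for s
  have v: "v < CARD('p)" using dig by (simp add: v_def)
  have p: "1 < CARD('p)" using prime_card[where 'a = 'p] by (rule prime_gt_1_nat)
  have ds: "digit_sum b y i (Suc N) = d + v" by (simp add: d_def v_def digit_sum_Suc)
  have IH1: "P $ r $ m = 0" if "r \<le> d" "m < F i r" for r m using Suc.IH[of r] that by (simp add: P_def d_def)
  have IH2: "P $ r $ F i r \<noteq> 0" if "r \<le> d" for r using Suc.IH[of r] that by (simp add: P_def d_def)
  have IH3: "P $ r = 0" if "d < r" for r using Suc.IH[of r] that by (simp add: P_def d_def)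
  have e: "(CARD('p) ^ b) ^ N * CARD('p) ^ i = e"
    by (simp add: e_def power_add flip: power_mult)
  have "beta_part T b y i (Suc N) = (1 - fps_const (fps_X ^ e) * fps_X) ^ v * P"
    unfolding beta_part_def P_def v_def prod.lessThan_Suc e by (rule mult.commute)
  then have nth: "beta_part T b y i (Suc N) $ r $ m
      = (\<Sum>s\<le>r. k s * (if m < e * s then 0 else P $ (r - s) $ (m - e * s)))" for r m
  proof -
    have "of_nat (v choose s) * (- (fps_X ^ e)) ^ s = (fps_const (k s) * fps_X ^ (e * s) :: 'p mod_ring fps)" for s
      by (simp add: k_def power_minus[of "fps_X ^ e"] power_mult flip: fps_of_nat fps_const_mult)
        (simp flip: fps_const_power fps_const_neg)
    then have "beta_part T b y i (Suc N) $ r = (\<Sum>s = 0..r. (fps_const (k s) * fps_X ^ (e * s)) * P $ (r - s))"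
      by (simp only: \<open>beta_part T b y i (Suc N) = _\<close> fps_mult_nth one_minus_const_X_power_nth)
    then show ?thesis
      by (simp add: fps_sum_nth mult.assoc fps_X_power_mult_nth atLeast0AtMost)
  qed
  have expo_le: "CARD('p) ^ token_expo b y i t \<le> e" if "t < d + v" for t
    using digit_index_le_iff[OF inf, of t N] that p b ds by (simp add: e_def token_expo_def)
  have expo_less: "CARD('p) ^ token_expo b y i t < e" if "t < d" for t
    using digit_index_less_iff[OF inf, of t N] that p b by (simp add: e_def token_expo_def d_def)
  have expo_eq: "CARD('p) ^ token_expo b y i t = e" if "d \<le> t" "t < d + v" for t
    using digit_index_less_iff[OF inf, of t N] digit_index_le_iff[OF inf, of t N] that ds
    by (auto simp: e_def token_expo_def d_def intro: antisym)
  have F_add: "F i (r + s) = F i r + (\<Sum>t<s. CARD('p) ^ token_expo b y i (r + t))" for r s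
    unfolding F_def by (induction s) auto
  show ?case
  proof (intro conjI impI allI)
    assume "digit_sum b y i (Suc N) < r"
    then have "k s = 0 \<or> P $ (r - s) = 0" for s
      using IH3[of "r - s"] ds by (cases "s \<le> v") (auto simp: k_def binomial_eq_0)
    then have "beta_part T b y i (Suc N) $ r $ m = 0" for m
      unfolding nth by (intro sum.neutral) force
    then show "beta_part T b y i (Suc N) $ r = 0" by (simp add: fps_eq_iff)
  next
    assume "r \<le> digit_sum b y i (Suc N)"
    then have r: "r \<le> d + v" by (simp add: ds)
    \<comment> \<open>The new factor carries the largest token, so the lowest term uses it as rarely
      as possible: not at all for r <= d, and r - d times otherwise.\<close>
    define s0 where "s0 = r - d"
    have s0: "s0 \<le> r" "s0 \<le> v" "r - s0 \<le> d" using r by (auto simp: s0_def)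
    have F_s0: "F i r = F i (r - s0) + e * s0"
    proof -
      have "(\<Sum>t<s0. CARD('p) ^ token_expo b y i (r - s0 + t)) = (\<Sum>t<s0. e)"
        using r by (intro sum.cong expo_eq refl) (auto simp: s0_def)
      then show ?thesis using F_add[of "r - s0" s0] s0(1) by simp
    qed
    \<comment> \<open>Using the new factor more often replaces at least one token below e by
      e.\<close>
    have F_less: "F i r < F i (r - s) + e * s" if "s0 < s" "s \<le> r" for s
    proof -
      have "(\<Sum>t<s. CARD('p) ^ token_expo b y i (r - s + t)) < (\<Sum>t<s. e)"
      proof (rule sum_strict_mono_ex1)
        show "\<forall>t\<in>{..<s}. CARD('p) ^ token_expo b y i (r - s + t) \<le> e"
          using that r by (auto intro: expo_le)
        show "\<exists>t\<in>{..<s}. CARD('p) ^ token_expo b y i (r - s + t) < e"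
          using that by (intro bexI[of _ 0] expo_less) (auto simp: s0_def)
      qed simp
      then show ?thesis using F_add[of "r - s" s] that by (simp add: mult.commute)
    qed
    have terms: "k s * (if m < e * s then 0 else P $ (r - s) $ (m - e * s)) = 0"
      if "s \<le> r" "m \<le> F i r" "s \<noteq> s0 \<or> m < F i r" for s m
    proof (cases "s < s0")
      case True
      then show ?thesis using IH3[of "r - s"] by (simp add: s0_def)
    next
      case False
      then have "m < F i (r - s) + e * s"
        using F_less[of s] F_s0 that by (cases "s = s0") auto
      then show ?thesis using IH1[of "r - s" "m - e * s"] False s0(3) by auto
    qed
    show "beta_part T b y i (Suc N) $ r $ m = 0" if "m < F i r" for m
      unfolding nth using terms that by (intro sum.neutral) auto
    have "beta_part T b y i (Suc N) $ r $ F i r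
        = (\<Sum>s\<in>{s0}. k s * (if F i r < e * s then 0 else P $ (r - s) $ (F i r - e * s)))"
      unfolding nth using terms s0 by (intro sum.mono_neutral_right) auto
    also have "\<dots> = k s0 * P $ (r - s0) $ F i (r - s0)" by (simp add: F_s0)
    also have "\<dots> \<noteq> 0"
      using IH2[OF s0(3)] of_nat_binomial_mod_ring_neq_0[OF v s0(2)] by (simp add: k_def)
    finally show "beta_part T b y i (Suc N) $ r $ F i r \<noteq> 0" .
  qed
qed

lemma vpi_eqI:
  assumes "\<And>m. m < n \<Longrightarrow> g $ m = 0" "g $ n \<noteq> 0"
  shows "vpi g = enat n"
proof -
  have "subdegree g = n" using assms by (intro subdegreeI) auto
  moreover have "g \<noteq> 0" using assms(2) by auto
  ultimately show ?thesis by (simp add: vpi_def)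
qed

lemma vpi_a_coeff:
  fixes T :: "'p::prime_card itself"
  assumes inf: "infinite {j. ydig b y i j \<noteq> 0}" and dig: "\<And>j. ydig b y i j < CARD('p)" and b: "0 < b"
  shows "vpi (a_coeff T b y i (int r)) = enat (\<Sum>s<r. CARD('p) ^ token_expo b y i s)"
proof (rule vpi_eqI)
  let ?F = "\<lambda>r. \<Sum>s<r. CARD('p) ^ token_expo b y i s"
  note nth = beta_part_nth[OF inf dig b, where T = T and r = r]
  \<comment> \<open>A partial product with fewer than r tokens has no theta^r term, so the
    coefficient vanishes in this case as well.\<close>
  show "a_coeff T b y i (int r) $ m = 0" if "m < ?F r" for m
    using nth[of "Suc m"] that by (cases "r \<le> digit_sum b y i (Suc m)") (auto simp: a_coeff_def)
  define m where "m = ?F r"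
  have p: "1 < CARD('p)" using prime_card[where 'a = 'p] by (rule prime_gt_1_nat)
  \<comment> \<open>If the first m + 1 factors held fewer than r tokens, the r-th token would have
    index above m, and its power of p alone would exceed m, the sum of the first r tokens.\<close>
  have "r \<le> digit_sum b y i (Suc m)"
  proof (rule ccontr)
    assume "\<not> ?thesis"
    then have "Suc m \<le> digit_index b y i (r - 1)" "0 < r"
      using digit_index_less_iff[OF inf, of "r - 1" "Suc m"] by auto
    have "Suc m \<le> b * Suc m" using b by (cases b) auto
    also have "\<dots> \<le> b * digit_index b y i (r - 1)"
      using \<open>Suc m \<le> digit_index b y i (r - 1)\<close> by (rule mult_le_mono2)
    also have "\<dots> \<le> token_expo b y i (r - 1)" by (simp add: token_expo_def)
    also have "\<dots> < CARD('p) ^ token_expo b y i (r - 1)" using p by (simp add: power_gt_expt)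
    also have "\<dots> \<le> m" unfolding m_def using \<open>0 < r\<close> by (intro member_le_sum) auto
    finally show False by simp
  qed
  then show "a_coeff T b y i (int r) $ ?F r \<noteq> 0"
    using nth[of "Suc m"] by (simp add: a_coeff_def m_def)
qed

section \<open>Enriched permutations and chains\<close>

lemma sum_enat: "(\<Sum>k\<in>S. enat (g k)) = enat (\<Sum>k\<in>S. g k)"
  using of_nat_sum[of g S, where 'a = enat] by (simp add: of_nat_eq_enat)

lemma sum_enat_infinity:
  fixes g :: "'a \<Rightarrow> enat"
  assumes "finite S" "k \<in> S" "g k = \<infinity>"
  shows "sum g S = \<infinity>"
  using assms by (simp add: sum.remove)

lemma sorted_distinct_map_eq:
  fixes h :: "'a::linorder \<Rightarrow> 'b::linorder"
  assumes "finite A" and mono: "strict_mono_on A h" and "k < card A"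
  shows "h (sorted_list_of_set A ! k) = sorted_list_of_set (h ` A) ! k"
proof -
  have "map h (sorted_list_of_set A) = sorted_list_of_set (h ` A)"
  proof (rule sorted_distinct_set_unique)
    have "sorted_wrt (<) (sorted_list_of_set A)" by simp
    then have "sorted_wrt (\<lambda>x z. h x < h z) (sorted_list_of_set A)"
      by (rule sorted_wrt_mono_rel[rotated]) (use mono assms(1) in \<open>auto simp: strict_mono_on_def\<close>)
    then have "sorted_wrt (<) (map h (sorted_list_of_set A))" by (simp add: sorted_wrt_map)
    then show "sorted (map h (sorted_list_of_set A))" "distinct (map h (sorted_list_of_set A))"
      by (simp_all add: strict_sorted_iff)
  qed (use assms(1) in auto)
  then show ?thesis using assms by (metis length_sorted_list_of_set nth_map)
qed

section \<open>The matrix as an instance of the token model\<close>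

locale full_digits =
  fixes T :: "'p::prime_card itself" and b :: nat and y :: "nat \<Rightarrow> nat"
  assumes b1: "1 \<le> b" and digits: "p_digits T y" and full: "q_full b y"
begin

lemma ydig_less: "ydig b y i j < CARD('p)"
  using digits by (simp add: p_digits_def ydig_def)

lemma inf: "i < b \<Longrightarrow> infinite {j. ydig b y i j \<noteq> 0}"
  using full by (simp add: q_full_def)

text \<open>The label l carries the tokens of the class following l, since the argument
  CARD('p) * x (cyc_suc l) - x l of a pair of consecutive coordinates is indexed by l.\<close>

definition label_expo :: "nat \<Rightarrow> nat \<Rightarrow> nat" where
  "label_expo l = token_expo b y ((l + 1) mod b)"

text \<open>The residue of an exponent modulo b determines the label, and digits below p give
  \<open>expo_shift\<close>.\<close>

sublocale cyclic_tokens "CARD('p)" b label_expo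
proof
  have mod_inj: "l = l'" if "l < b" "l' < b" "(l + 1) mod b = (l' + 1) mod b" for l l'
    using that by (simp add: mod_Suc split: if_splits)
  show "2 \<le> CARD('p)" using prime_card[where 'a = 'p] by (rule prime_ge_2_nat)
  show "0 < b" using b1 by simp
  fix l assume l: "l < b"
  then have i: "(l + 1) mod b < b" using b1 by simp
  show "label_expo l s \<le> label_expo l s'" if "s \<le> s'" for s s'
    unfolding label_expo_def using token_expo_mono[OF inf[OF i] that] .
  show "label_expo l s < label_expo l (s + (CARD('p) - 1))" for s
    unfolding label_expo_def using b1 ydig_less by (intro token_expo_shift[OF inf[OF i]]) auto
  fix l' s s'
  assume l': "l' < b" and eq: "label_expo l s = label_expo l' s'"
  have "label_expo k t mod b = (k + 1) mod b" for k t
    by (simp add: label_expo_def token_expo_def)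
  then show "l = l'" using mod_inj[OF l l'] eq by metis
qed

lemma vpi_Psi:
  assumes "l < b"
  shows "vpi (Psi T b y (cyc_suc l, m) (l, m')) =
    (if m' \<le> CARD('p) * m then enat (token_sum l (CARD('p) * m - m')) else \<infinity>)"
proof (cases "m' \<le> CARD('p) * m")
  case True
  then have "Psi T b y (cyc_suc l, m) (l, m') = a_coeff T b y (cyc_suc l) (int (CARD('p) * m - m'))"
    by (simp add: Psi_def cyc_suc_def of_nat_diff)
  then show ?thesis
    using True vpi_a_coeff[OF inf[OF cyc_suc_less] ydig_less b_pos, where T = T and r = "CARD('p) * m - m'"]
    by (simp add: token_sum_def label_expo_def cyc_suc_def)
next
  case False
  then have "Psi T b y (cyc_suc l, m) (l, m') = 0"
    by (simp add: Psi_def a_coeff_def flip: of_nat_mult)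
  then show ?thesis using False by (simp add: vpi_def)
qed

section \<open>Costs of permutations and their correspondence with chains\<close>

definition admE :: "enriched_perm \<Rightarrow> bool" where
  "admE E \<longleftrightarrow> (\<forall>z\<in>fst E. snd (snd E z) \<le> CARD('p) * snd z)"

definition edge :: "enriched_perm \<Rightarrow> nat \<times> nat \<Rightarrow> nat" where
  "edge E z = token_sum (fst (snd E z)) (CARD('p) * snd z - snd (snd E z))"

definition costE :: "enriched_perm \<Rightarrow> nat" where
  "costE E = (\<Sum>z\<in>fst E. edge E z)"

lemma rotationalD:
  assumes "rotational_of_size b n E" "z \<in> fst E"
  shows "snd E z \<in> fst E" "fst (snd E z) < b" "fst z = cyc_suc (fst (snd E z))" "0 < snd z"
proof -
  show "snd E z \<in> fst E" using assms by (auto simp: rotational_of_size_def permutes_in_image)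
  then show "fst (snd E z) < b" "fst z = cyc_suc (fst (snd E z))" "0 < snd z"
    using assms by (auto simp: rotational_of_size_def J1_def cyc_suc_def)
qed

lemma vsig_eq:
  assumes E: "rotational_of_size b n E"
  shows "vsig T b y E = (if admE E then enat (costE E) else \<infinity>)"
proof -
  have v: "vpi (Psi T b y z (snd E z)) =
      (if snd (snd E z) \<le> CARD('p) * snd z then enat (edge E z) else \<infinity>)" if z: "z \<in> fst E" for z
    using vpi_Psi[of "fst (snd E z)" "snd z" "snd (snd E z)"] rotationalD[OF E z]
    by (simp add: edge_def prod_eq_iff[symmetric] split: if_splits) (metis prod.collapse)+
  show ?thesis
  proof (cases "admE E")
    case True
    then have "vsig T b y E = (\<Sum>z\<in>fst E. enat (edge E z))"
      unfolding vsig_def using v by (intro sum.cong) (auto simp: admE_def)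
    then show ?thesis using True by (simp add: sum_enat costE_def)
  next
    case False
    then obtain z where "z \<in> fst E" "\<not> snd (snd E z) \<le> CARD('p) * snd z" by (auto simp: admE_def)
    moreover have "finite (fst E)" using E by (simp add: rotational_of_size_def)
    ultimately show ?thesis unfolding vsig_def using False v by (simp add: sum_enat_infinity)
  qed
qed

text \<open>Each X k is a cycle meeting every class once, traversed against \<open>cyc_suc\<close>.
  Requiring the identity off the support makes the permutation determined by X.\<close>

definition represents :: "nat \<Rightarrow> (nat \<Rightarrow> nat \<Rightarrow> nat) \<Rightarrow> enriched_perm \<Rightarrow> bool" where
  "represents n X E \<longleftrightarrow> fst E = (\<lambda>(l, k). (l, X k l)) ` ({..<b} \<times> {..<n}) \<and>
     (\<forall>l<b. \<forall>k<n. snd E (cyc_suc l, X k (cyc_suc l)) = (l, X k l)) \<and> (\<forall>z. z \<notin> fst E \<longrightarrow> snd E z = z)"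

lemma fst_represents:
  assumes "represents n X E"
  shows "fst E = (\<lambda>(l, k). (cyc_suc l, X k (cyc_suc l))) ` ({..<b} \<times> {..<n})"
proof -
  have "{..<b} \<times> {..<n} = map_prod cyc_suc id ` ({..<b} \<times> {..<n})"
    using bij_cyc_suc by (simp add: map_prod_surj_on bij_betw_def)
  then have "fst E = (\<lambda>(l, k). (l, X k l)) ` map_prod cyc_suc id ` ({..<b} \<times> {..<n})"
    using assms by (simp add: represents_def)
  also have "\<dots> = ((\<lambda>(l, k). (l, X k l)) \<circ> map_prod cyc_suc id) ` ({..<b} \<times> {..<n})"
    by (simp only: image_comp)
  also have "(\<lambda>(l, k). (l, X k l)) \<circ> map_prod cyc_suc id = (\<lambda>(l, k). (cyc_suc l, X k (cyc_suc l)))"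
    by (simp add: fun_eq_iff)
  finally show ?thesis .
qed

lemma represents_unique:
  assumes E: "represents n X E" and E': "represents n X' E'" and eq: "\<And>k l. k < n \<Longrightarrow> l < b \<Longrightarrow> X k l = X' k l"
  shows "E = E'"
proof (rule prod_eqI)
  show fst: "fst E = fst E'" using assms by (auto simp: represents_def intro!: image_cong)
  show "snd E = snd E'"
  proof
    fix z
    show "snd E z = snd E' z"
    proof (cases "z \<in> fst E")
      case True
      then obtain l k where "l < b" "k < n" "z = (cyc_suc l, X k (cyc_suc l))" by (auto simp: fst_represents[OF E])
      moreover have "snd E (cyc_suc l, X k (cyc_suc l)) = (l, X k l)" "snd E' (cyc_suc l, X' k (cyc_suc l)) = (l, X' k l)"
        using E E' \<open>l < b\<close> \<open>k < n\<close> by (simp_all add: represents_def)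
      ultimately show ?thesis using eq[of k l] eq[of k "cyc_suc l"] by simp
    next
      case False
      then have "snd E z = z" using E unfolding represents_def by blast
      moreover have "snd E' z = z" using E' False fst unfolding represents_def by metis
      ultimately show ?thesis by simp
    qed
  qed
qed

lemma chain_inj_on_pairs:
  assumes "chain n B X"
  shows "inj_on (\<lambda>(l, k). (l, X k l)) ({..<b} \<times> {..<n})"
  using chain_inj_on[OF assms] by (auto simp: inj_on_def)

lemma represents_cost:
  assumes X: "chain n B X" and E: "represents n X E"
  shows "admE E" "costE E = cost n X"
proof -
  let ?D = "{..<b} \<times> {..<n}" and ?g = "\<lambda>(l, k). (cyc_suc l, X k (cyc_suc l))"
  have F: "fst E = ?g ` ?D" by (rule fst_represents[OF E])
  have sE: "snd E (cyc_suc l, X k (cyc_suc l)) = (l, X k l)" if "l < b" "k < n" for l k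
    using E that by (simp add: represents_def)
  show "admE E" using X unfolding admE_def F by (auto simp: sE chain_def admissible_def)
  have "inj_on ((\<lambda>(l, k). (l, X k l)) \<circ> map_prod cyc_suc id) ?D"
    using bij_cyc_suc chain_inj_on_pairs[OF X]
    by (intro comp_inj_on map_prod_inj_on) (auto simp: bij_betw_def map_prod_surj_on)
  then have "inj_on ?g ?D" by (simp add: o_def case_prod_unfold)
  then have "costE E = (\<Sum>z\<in>?D. edge E (?g z))" by (simp add: costE_def F sum.reindex)
  also have "\<dots> = (\<Sum>(l, k)\<in>?D. token_sum l (arg (X k) l))"
    by (rule sum.cong) (auto simp: edge_def sE arg_def)
  also have "\<dots> = (\<Sum>l<b. \<Sum>k<n. token_sum l (arg (X k) l))" by (rule sum.cartesian_product[symmetric])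
  also have "\<dots> = cost n X" unfolding cost_def weight_def by (rule sum.swap)
  finally show "costE E = cost n X" .
qed

lemma chain_represented:
  assumes X: "chain n B X"
  shows "\<exists>E. rotational_of_size b n E \<and> represents n X E"
proof -
  let ?D = "{..<b} \<times> {..<n}" and ?h = "\<lambda>(l, k). (l, X k l)"
  define S where "S = ?h ` ?D"
  have h: "bij_betw ?h ?D S" using chain_inj_on_pairs[OF X] by (simp add: bij_betw_def S_def)
  have r: "bij_betw (map_prod cyc_suc id) ?D ?D"
    using bij_cyc_suc by (auto simp: bij_betw_def map_prod_inj_on map_prod_surj_on)
  have hr: "bij_betw (?h \<circ> map_prod cyc_suc id) ?D S" by (rule bij_betw_trans[OF r h])
  \<comment> \<open>Inside S a point is read as the source of an edge (l, k) and sent to the target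
    of that edge.\<close>
  define s where "s z = (if z \<in> S then (?h \<circ> inv_into ?D (?h \<circ> map_prod cyc_suc id)) z else z)" for z
  have "bij_betw (?h \<circ> inv_into ?D (?h \<circ> map_prod cyc_suc id)) S S"
    by (rule bij_betw_trans[OF bij_betw_inv_into[OF hr] h])
  then have "bij_betw s S S" by (rule bij_betw_cong[THEN iffD1, rotated]) (simp add: s_def)
  then have perm: "s permutes S" by (rule bij_imp_permutes) (simp add: s_def)
  have s: "s (cyc_suc l, X k (cyc_suc l)) = (l, X k l)" if "l < b" "k < n" for l k
  proof -
    have "(?h \<circ> map_prod cyc_suc id) (l, k) = (cyc_suc l, X k (cyc_suc l))" by simp
    moreover have "(cyc_suc l, X k (cyc_suc l)) \<in> S" using that by (force simp: S_def)
    ultimately show ?thesis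
      using inv_into_f_f[OF bij_betw_imp_inj_on[OF hr], of "(l, k)"] that by (simp add: s_def)
  qed
  have rep: "represents n X (S, s)" using s by (auto simp: represents_def S_def[symmetric] s_def)
  have "rotational_of_size b n (S, s)"
    unfolding rotational_of_size_def fst_conv snd_conv
  proof (intro conjI ballI)
    show "finite S" by (simp add: S_def)
    show "S \<subseteq> J1 b" using X by (auto simp: S_def J1_def chain_def)
    show "card S = n * b" using bij_betw_same_card[OF h] by (simp add: mult.commute)
    fix z assume "z \<in> S"
    then obtain l k where "l < b" "k < n" "z = (cyc_suc l, X k (cyc_suc l))" using fst_represents[OF rep] by auto
    then show "(fst (s z) + 1) mod b = fst z" using s by (simp add: cyc_suc_def)
  qed (rule perm)
  then show ?thesis using rep by blast
qed

text \<open>Exchanging the images of a crossing pair strictly lowers the cost by strict convexity.\<close>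

lemma minimal_monotone:
  assumes E: "rotational_of_size b n E" and fin: "admE E"
    and minimal: "\<And>E'. rotational_of_size b n E' \<Longrightarrow> vsig T b y E \<le> vsig T b y E'"
    and z: "z1 \<in> fst E" "z2 \<in> fst E" "fst z1 = fst z2" "snd z1 < snd z2"
  shows "snd (snd E z1) < snd (snd E z2)"
proof (rule ccontr)
  assume nless: "\<not> ?thesis"
  define s where "s = snd E"
  define S where "S = fst E"
  have S: "finite S" "s permutes S" using E by (auto simp: rotational_of_size_def s_def S_def)
  note D = rotationalD[OF E]
  have "z1 \<noteq> z2" using z by auto
  obtain l where l: "l < b" "fst (s z1) = l" "fst (s z2) = l"
    using D[OF z(1)] D[OF z(2)] z(3) bij_cyc_suc by (auto simp: s_def bij_betw_def inj_on_def)
  have "s z1 \<noteq> s z2" using \<open>z1 \<noteq> z2\<close> permutes_inj[OF S(2)] by (auto dest: injD)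
  then have lt: "snd (s z2) < snd (s z1)"
    using nless l by (auto simp: s_def prod_eq_iff)
  define s' where "s' = s \<circ> transpose z1 z2"
  have s'_simps: "s' z1 = s z2" "s' z2 = s z1" "\<And>z. z \<noteq> z1 \<Longrightarrow> z \<noteq> z2 \<Longrightarrow> s' z = s z"
    by (auto simp: s'_def)
  have "s' permutes S" unfolding s'_def
    using S(2) z by (intro permutes_compose permutes_swap_id) (auto simp: S_def)
  then have E': "rotational_of_size b n (S, s')"
    using E z l s'_simps unfolding rotational_of_size_def S_def s_def fst_conv snd_conv by metis
  have bound: "snd (s z) \<le> CARD('p) * snd z" if "z \<in> S" for z
    using fin that by (auto simp: admE_def S_def s_def)
  have b1: "snd (s z1) \<le> CARD('p) * snd z1" using bound z by (simp add: S_def)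
  \<comment> \<open>The larger image is already admissible for the smaller source, so no exchanged
    entry vanishes.\<close>
  have fin': "admE (S, s')"
    unfolding admE_def fst_conv snd_conv
  proof
    fix z assume z': "z \<in> S"
    have "CARD('p) * snd z1 \<le> CARD('p) * snd z2" using z by simp
    then have "snd (s z1) \<le> CARD('p) * snd z2" using b1 by (rule order_trans[rotated])
    then show "snd (s' z) \<le> CARD('p) * snd z"
      using b1 lt bound[OF z'] s'_simps by (cases "z = z1"; cases "z = z2") auto
  qed
  have split: "(\<Sum>z\<in>S. g z) = g z1 + g z2 + (\<Sum>z\<in>S - {z1} - {z2}. g z)" for g :: "nat \<times> nat \<Rightarrow> nat"
    using sum.remove[OF S(1), of z1 g] sum.remove[of "S - {z1}" z2 g] S(1) z \<open>z1 \<noteq> z2\<close>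
    by (simp add: S_def)
  have rest: "(\<Sum>z\<in>S - {z1} - {z2}. edge (S, s') z) = (\<Sum>z\<in>S - {z1} - {z2}. edge E z)"
    by (rule sum.cong) (auto simp: edge_def s'_simps s_def)
  have "edge (S, s') z1 + edge (S, s') z2 < edge E z1 + edge E z2"
    using token_sum_crossing_strict[OF l(1) z(4) lt b1] l s'_simps by (simp add: edge_def s_def[symmetric])
  then have "costE (S, s') < costE E"
    using rest by (simp add: costE_def split S_def[symmetric])
  then show False using minimal[OF E'] vsig_eq[OF E] vsig_eq[OF E'] fin fin' by simp
qed

text \<open>By \<open>minimal_monotone\<close> the permutation is an increasing bijection from each
  class to the preceding one. All classes therefore have n elements and the k-th element goes to the
  k-th; X k collects these k-th elements.\<close>

lemma minimal_represented:
  assumes E: "rotational_of_size b n E" and fin: "admE E"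
    and minimal: "\<And>E'. rotational_of_size b n E' \<Longrightarrow> vsig T b y E \<le> vsig T b y E'"
  shows "\<exists>X B. chain n B X \<and> represents n X E"
proof -
  define S where "S = fst E"
  define s where "s = snd E"
  define A where "A l = {m. (l, m) \<in> S}" for l
  have S: "finite S" "s permutes S" "card S = n * b" "S \<subseteq> J1 b"
    using E by (auto simp: rotational_of_size_def S_def s_def)
  note D = rotationalD[OF E, folded S_def s_def]
  have SA: "S = Sigma {..<b} A" using S(4) by (auto simp: A_def J1_def)
  have finA: "finite (A l)" for l
    using finite_imageI[OF S(1), of snd] by (rule finite_subset[rotated]) (force simp: A_def)
  define h where "h l m = snd (s (cyc_suc l, m))" for l m
  have hs: "s (cyc_suc l, m) = (l, h l m)" if l: "l < b" and m: "m \<in> A (cyc_suc l)" for l m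
  proof -
    have "cyc_suc (fst (s (cyc_suc l, m))) = cyc_suc l" "fst (s (cyc_suc l, m)) < b"
      using D[of "(cyc_suc l, m)"] m by (auto simp: A_def)
    then have "fst (s (cyc_suc l, m)) = l" using bij_cyc_suc l by (auto simp: bij_betw_def inj_on_def)
    then show ?thesis by (simp add: h_def prod_eq_iff)
  qed
  have mono: "strict_mono_on (A (cyc_suc l)) (h l)" if l: "l < b" for l
    using minimal_monotone[OF E fin minimal] unfolding strict_mono_on_def h_def s_def
    by (auto simp: A_def S_def)
  have img: "h l ` A (cyc_suc l) = A l" if l: "l < b" for l
  proof
    show "h l ` A (cyc_suc l) \<subseteq> A l" using hs[OF l] D(1) by (force simp: A_def)
    show "A l \<subseteq> h l ` A (cyc_suc l)"
    proof
      fix m assume "m \<in> A l"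
      then have "(l, m) \<in> s ` S" using permutes_image[OF S(2)] by (simp add: A_def)
      then obtain z where z: "z \<in> S" "s z = (l, m)" by (metis imageE)
      then have "z = (cyc_suc l, snd z)" using D(3)[OF z(1)] by (simp add: prod_eq_iff)
      then show "m \<in> h l ` A (cyc_suc l)"
        using z by (intro image_eqI[of _ _ "snd z"]) (auto simp: h_def A_def)
    qed
  qed
  have card_sc: "card (A l) = card (A (cyc_suc l))" if "l < b" for l
    using card_image[OF strict_mono_on_imp_inj_on[OF mono[OF that]]] img[OF that] by simp
  have card0: "card (A l) = card (A 0)" if "l < b" for l
    using that
  proof (induction l)
    case (Suc l)
    then show ?case using card_sc[of l] by (simp add: cyc_suc_def)
  qed simp
  have cardA: "card (A l) = n" if "l < b" for l
  proof -
    have "card S = (\<Sum>l<b. card (A l))" unfolding SA using finA by simp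
    also have "\<dots> = (\<Sum>l<b. card (A 0))" by (rule sum.cong[OF refl], rule card0) simp
    finally have "n * b = card (A 0) * b" using S(3) by auto
    then show ?thesis using card0[OF that] b_pos by simp
  qed
  define X where "X k l = sorted_list_of_set (A l) ! k" for k l
  have X_in: "X k l \<in> A l" if "k < n" "l < b" for k l
    using that finA cardA by (metis X_def length_sorted_list_of_set nth_mem set_sorted_list_of_set)
  have X_surj: "\<exists>k<n. m = X k l" if "m \<in> A l" "l < b" for m l
    using that finA cardA unfolding X_def
    by (metis in_set_conv_nth length_sorted_list_of_set set_sorted_list_of_set)
  have sX: "s (cyc_suc l, X k (cyc_suc l)) = (l, X k l)" if l: "l < b" and k: "k < n" for l k
    using sorted_distinct_map_eq[OF finA mono[OF l], of k] cardA[of "cyc_suc l"] k hs[OF l X_in[OF k]] img[OF l]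
    by (simp add: X_def)
  have "represents n X E"
    unfolding represents_def S_def[symmetric] s_def[symmetric]
  proof (intro conjI allI impI)
    show "S = (\<lambda>(l, k). (l, X k l)) ` ({..<b} \<times> {..<n})"
      using X_in X_surj by (force simp: SA)
    show "s z = z" if "z \<notin> S" for z using S(2) that by (rule permutes_not_in)
  qed (use sX in auto)
  \<comment> \<open>Inserting 0 makes the maximum meaningful for n = 0, when the classes are
    empty.\<close>
  moreover have "chain n (\<lambda>l. Max (insert 0 (A l))) X"
    unfolding chain_def
  proof (intro conjI allI impI)
    fix k assume k: "k < n"
    have "X k l \<le> CARD('p) * X k (cyc_suc l)" if l: "l < b" for l
      using fin sX[OF l k] X_in[OF k, of "cyc_suc l"]
      by (auto simp: admE_def S_def[symmetric] s_def[symmetric] A_def)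
    then show "admissible (X k)" by (simp add: admissible_def)
    fix l assume l: "l < b"
    show "0 < X k l" using X_in[OF k l] S(4) by (auto simp: A_def J1_def)
    show "X k l \<le> Max (insert 0 (A l))" using X_in[OF k l] finA by (intro Max_ge) auto
  next
    fix k l assume "Suc k < n" "l < b"
    then show "X k l < X (Suc k) l"
      unfolding X_def using strict_sorted_list_of_set[of "A l"] cardA[of l]
      by (simp add: sorted_wrt_nth_less)
  qed
  ultimately show ?thesis by blast
qed

text \<open>A minimum exists since the values are well-ordered, and it is finite by comparison with
  the constant vectors. Every minimizer is represented by a best chain, so two minimizers agree by
  \<open>best_unique\<close>.\<close>

lemma unique_minimum:
  "\<exists>E X. rotational_of_size b n E \<and> (\<forall>E'. rotational_of_size b n E' \<and> E' \<noteq> E \<longrightarrow> vsig T b y E < vsig T b y E') \<and>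
     best n X \<and> vsig T b y E = enat (cost n X)"
proof -
  obtain E1 where E1: "rotational_of_size b n E1" "represents n (\<lambda>k _. Suc k) E1"
    using chain_represented[OF chain_Suc] by blast
  define R where "R = {E. rotational_of_size b n E}"
  have "(LEAST v. v \<in> vsig T b y ` R) \<in> vsig T b y ` R"
    by (rule LeastI[of _ "vsig T b y E1"]) (use E1(1) in \<open>simp add: R_def\<close>)
  then obtain Emin where Emin: "Emin \<in> R" "vsig T b y Emin = (LEAST v. v \<in> vsig T b y ` R)"
    by (metis imageE)
  then have Emin_le: "vsig T b y Emin \<le> vsig T b y E" if "E \<in> R" for E
    using that by (simp add: Least_le)
  have min_best: "\<exists>X. represents n X E \<and> best n X \<and> vsig T b y E = enat (cost n X)"
    if E: "E \<in> R" and minimal: "\<And>E'. E' \<in> R \<Longrightarrow> vsig T b y E \<le> vsig T b y E'" for E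
  proof -
    have rot: "rotational_of_size b n E" using E by (simp add: R_def)
    have "vsig T b y E \<le> vsig T b y E1" using minimal E1 by (simp add: R_def)
    also have "\<dots> < \<infinity>" using vsig_eq[OF E1(1)] represents_cost[OF chain_Suc E1(2)] by simp
    finally have fin: "admE E" using vsig_eq[OF rot] by (auto split: if_splits)
    then obtain X B where X: "chain n B X" "represents n X E"
      using minimal_represented[OF rot] minimal by (auto simp: R_def)
    have v: "vsig T b y E = enat (cost n X)"
      using vsig_eq[OF rot] fin represents_cost[OF X] by simp
    have "cost n X \<le> cost n Y" if Y: "chain n B' Y" for B' Y
    proof -
      obtain E' where E': "rotational_of_size b n E'" "represents n Y E'"
        using chain_represented[OF Y] by blast
      then have "vsig T b y E' = enat (cost n Y)"
        using vsig_eq[OF E'(1)] represents_cost[OF Y E'(2)] by simp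
      then show ?thesis using minimal[of E'] E' v by (simp add: R_def)
    qed
    then show ?thesis using X v by (auto simp: best_def)
  qed
  obtain X where X: "represents n X Emin" "best n X" "vsig T b y Emin = enat (cost n X)"
    using min_best[OF Emin(1) Emin_le] by blast
  have "vsig T b y Emin < vsig T b y E" if E: "E \<in> R" "E \<noteq> Emin" for E
  proof (rule ccontr)
    assume "\<not> ?thesis"
    then have "vsig T b y E \<le> vsig T b y E'" if "E' \<in> R" for E'
      using Emin_le[OF that] by (meson leI order_trans)
    then obtain X' where "represents n X' E" "best n X'" using min_best[OF E(1)] by blast
    then have "E = Emin" using X represents_unique best_unique by metis
    then show False using E by simp
  qed
  then show ?thesis
    using Emin(1) X by (intro exI[of _ Emin] exI[of _ X]) (simp add: R_def del: split_paired_All)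
qed

end

theorem theorem6p12:
  fixes b :: nat and y :: "nat \<Rightarrow> nat"
  assumes "b \<ge> 1"
    and "p_digits TYPE('p::prime_card) y"
    and "q_full b y"
  shows "\<exists>\<Sigma> :: nat \<Rightarrow> enriched_perm.
           \<Sigma> 0 = ({}, id) \<and>
           (\<forall>n\<ge>1. rotational_of_size b n (\<Sigma> n) \<and>
                   (\<forall>E. rotational_of_size b n E \<and> E \<noteq> \<Sigma> n \<longrightarrow>
                        vsig TYPE('p) b y (\<Sigma> n) < vsig TYPE('p) b y E)) \<and>
           (\<forall>n\<ge>1.
              int (the_enat (vsig TYPE('p) b y (\<Sigma> (n + 1)))) - int (the_enat (vsig TYPE('p) b y (\<Sigma> n)))
              > int (the_enat (vsig TYPE('p) b y (\<Sigma> n))) - int (the_enat (vsig TYPE('p) b y (\<Sigma> (n - 1)))))"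
proof -
  interpret full_digits "TYPE('p)" b y by standard (use assms in auto)
  obtain G X where G: "\<And>n. rotational_of_size b n (G n)"
    "\<And>n E. rotational_of_size b n E \<Longrightarrow> E \<noteq> G n \<Longrightarrow> vsig TYPE('p) b y (G n) < vsig TYPE('p) b y E"
    and X: "\<And>n. best n (X n)" "\<And>n. vsig TYPE('p) b y (G n) = enat (cost n (X n))"
    using unique_minimum by metis
  \<comment> \<open>The value at 0 is prescribed; its valuation is 0, the cost of the empty chain,
    so \<open>v\<close> includes n = 0.\<close>
  define H where "H n = (if n = 0 then ({}, id) else G n)" for n
  have v: "the_enat (vsig TYPE('p) b y (H n)) = cost n (X n)" for n
    using X(2)[of n] by (simp add: H_def vsig_def cost_def zero_enat_def)
  have step: "int (cost (n + 1) (X (n + 1))) - int (cost n (X n)) > int (cost n (X n)) - int (cost (n - 1) (X (n - 1)))"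
    if "1 \<le> n" for n
    using best_convex[of "n - 1" "X (n + 1)" "X (n - 1)" "X n"] X(1) that by fastforce
  show ?thesis
  proof (intro exI[of _ H] conjI allI impI)
    show "H 0 = ({}, id)" by (simp add: H_def)
  next
    fix n :: nat assume n: "1 \<le> n"
    show "rotational_of_size b n (H n)" using G(1) n by (simp add: H_def)
    show "int (the_enat (vsig TYPE('p) b y (H (n + 1)))) - int (the_enat (vsig TYPE('p) b y (H n)))
        > int (the_enat (vsig TYPE('p) b y (H n))) - int (the_enat (vsig TYPE('p) b y (H (n - 1))))"
      unfolding v using step n .
    fix E assume "rotational_of_size b n E \<and> E \<noteq> H n"
    then show "vsig TYPE('p) b y (H n) < vsig TYPE('p) b y E" using G(2)[of n E] n by (simp add: H_def)
  qed
qed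

end
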